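(* Let $G$ be a $2$-connected graph of order $n$ with $n\ge 4$. Then $rx_3(G)\le n-2$, with equality if and only if at least one of the following holds: $G$ is isomorphic to the cycle $C_n$; $G$ is isomorphic to a spanning subgraph of the $3$-sun; $G$ is isomorphic to a spanning subgraph of $K_5-e$; $G$ is isomorphic to a spanning subgraph of $K_4$.
   Context: All graphs are finite, simple and undirected. Edge-colorings are arbitrary maps from $E(G)$ to a finite set of colors (adjacent edges may receive the same color). A tree $T$ that is a subgraph of an edge-colored graph $G$ is a rainbow tree if no two edges of $T$ have the same color. For $S\subseteq V(G)$, a rainbow $S$-tree is a rainbow tree in $G$ whose vertex set contains $S$ (it may contain other vertices). For a connected graph $G$ of order at least $3$, $rx_3(G)$ (the $3$-rainbow index) is the minimum number of colors in an edge-coloring of $G$ such that for every $3$-element subset $S$ of $V(G)$ there is a rainbow $S$-tree. The $3$-sun is the graph on $6$ vertices obtained from the cycle $C_6=v_1v_2v_3v_4v_5v_6v_1$ by adding the three edges $v_2v_4$, $v_2v_6$, $v_4v_6$. $K_5-e$ is the complete graph $K_5$ with one edge deleted. A spanning subgraph of $H$ is a subgraph with the same vertex set as $H$. *)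

theory Defs
  imports Main
begin

type_synonym 'a ugraph = "'a set \<times> 'a set set"

abbreviation verts :: "'a ugraph \<Rightarrow> 'a set" where
  "verts G \<equiv> fst G"

abbreviation edges :: "'a ugraph \<Rightarrow> 'a set set" where
  "edges G \<equiv> snd G"

definition simple_graph :: "'a ugraph \<Rightarrow> bool" where
  "simple_graph G \<longleftrightarrow>
     finite (verts G) \<and> (\<forall>e\<in>edges G. e \<subseteq> verts G \<and> card e = 2)"

definition adj :: "'a ugraph \<Rightarrow> 'a \<Rightarrow> 'a \<Rightarrow> bool" where
  "adj G u v \<longleftrightarrow> {u, v} \<in> edges G"

definition connected_graph :: "'a ugraph \<Rightarrow> bool" where
  "connected_graph G \<longleftrightarrow>
     verts G \<noteq> {} \<and> (\<forall>u\<in>verts G. \<forall>v\<in>verts G. (adj G)\<^sup>*\<^sup>* u v)"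

definition delete_verts :: "'a ugraph \<Rightarrow> 'a set \<Rightarrow> 'a ugraph" where
  "delete_verts G X = (verts G - X, {e \<in> edges G. e \<inter> X = {}})"

definition k_connected :: "nat \<Rightarrow> 'a ugraph \<Rightarrow> bool" where
  "k_connected k G \<longleftrightarrow>
     k < card (verts G) \<and>
     (\<forall>X. X \<subseteq> verts G \<and> card X < k \<longrightarrow> connected_graph (delete_verts G X))"

definition subgraph :: "'a ugraph \<Rightarrow> 'a ugraph \<Rightarrow> bool" where
  "subgraph H G \<longleftrightarrow>
     simple_graph H \<and> verts H \<subseteq> verts G \<and> edges H \<subseteq> edges G"

definition spanning_subgraph :: "'a ugraph \<Rightarrow> 'a ugraph \<Rightarrow> bool" where
  "spanning_subgraph H G \<longleftrightarrow> subgraph H G \<and> verts H = verts G"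

definition graph_iso :: "'a ugraph \<Rightarrow> 'b ugraph \<Rightarrow> bool" where
  "graph_iso G H \<longleftrightarrow>
     (\<exists>f. bij_betw f (verts G) (verts H) \<and>
          (\<forall>u\<in>verts G. \<forall>v\<in>verts G. adj G u v \<longleftrightarrow> adj H (f u) (f v)))"

text \<open>A cycle is given by the list of its vertices in cyclic order, without repeating the
  initial vertex at the end.\<close>

definition is_cycle :: "'a ugraph \<Rightarrow> 'a list \<Rightarrow> bool" where
  "is_cycle G vs \<longleftrightarrow>
     3 \<le> length vs \<and> distinct vs \<and>
     (\<forall>i<length vs. adj G (vs ! i) (vs ! (Suc i mod length vs)))"

definition is_tree :: "'a ugraph \<Rightarrow> bool" where
  "is_tree T \<longleftrightarrow> simple_graph T \<and> connected_graph T \<and> \<not> (\<exists>vs. is_cycle T vs)"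

definition rainbow_tree :: "('a set \<Rightarrow> 'c) \<Rightarrow> 'a ugraph \<Rightarrow> 'a ugraph \<Rightarrow> bool" where
  "rainbow_tree c G T \<longleftrightarrow> subgraph T G \<and> is_tree T \<and> inj_on c (edges T)"

definition rainbow_S_tree ::
  "('a set \<Rightarrow> 'c) \<Rightarrow> 'a ugraph \<Rightarrow> 'a set \<Rightarrow> 'a ugraph \<Rightarrow> bool" where
  "rainbow_S_tree c G S T \<longleftrightarrow> rainbow_tree c G T \<and> S \<subseteq> verts T"

definition three_rainbow_coloring :: "('a set \<Rightarrow> 'c) \<Rightarrow> 'a ugraph \<Rightarrow> bool" where
  "three_rainbow_coloring c G \<longleftrightarrow>
     (\<forall>S. S \<subseteq> verts G \<and> card S = 3 \<longrightarrow> (\<exists>T. rainbow_S_tree c G S T))"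

text \<open>Only meaningful for connected graphs of order at least 3. The values of \<open>c\<close> outside
  the edge set are irrelevant.\<close>

definition rx3 :: "'a ugraph \<Rightarrow> nat" where
  "rx3 G = (LEAST k. \<exists>c :: 'a set \<Rightarrow> nat.
              c ` edges G \<subseteq> {..<k} \<and> three_rainbow_coloring c G)"

definition complete_graph :: "nat \<Rightarrow> nat ugraph" where
  "complete_graph n = ({..<n}, {e. e \<subseteq> {..<n} \<and> card e = 2})"

text \<open>This is a cycle only for \<open>n \<ge> 3\<close>.\<close>

definition cycle_graph :: "nat \<Rightarrow> nat ugraph" where
  "cycle_graph n = ({..<n}, {{i, Suc i mod n} | i. i < n})"

definition K5_minus_edge :: "nat ugraph" where
  "K5_minus_edge = (verts (complete_graph 5), edges (complete_graph 5) - {{0, 1}})"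

definition three_sun :: "nat ugraph" where
  "three_sun = ({1..6},
     {{1, 2}, {2, 3}, {3, 4}, {4, 5}, {5, 6}, {6, 1}} \<union> {{2, 4}, {2, 6}, {4, 6}})"

end

theory Submission
  imports Defs
begin

text \<open>
  The quantity that governs the proof is the saving \<open>n - rx\<^sub>3(G)\<close>. It is monotone under minors:
  if \<open>H\<close> is a minor of the connected graph \<open>G\<close>, colour lifts of the edges of \<open>H\<close> as in \<open>H\<close>, and give
  spanning trees of the branch sets \<open>n - |H|\<close> further colours, all different. A rainbow tree of \<open>H\<close>
  together with all these spanning trees is then a rainbow connected subgraph of \<open>G\<close>
  (\<open>colorable_minor\<close>). So a saving of \<open>2\<close> or \<open>3\<close> in \<open>G\<close> only needs one small minor with that saving,
  and for each small minor a colouring can be written down together with rainbow trees that cover all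
  triples (\<open>colorable_certificate\<close>).

  The four-cycle saves \<open>2\<close>, and every 2-connected graph of order at least \<open>4\<close> contains it as a minor;
  this is the upper bound. The minors that save \<open>3\<close> are \<open>K\<^sub>5\<close>, \<open>K\<^sub>2\<^sub>,\<^sub>4\<close>, the theta graphs with path
  lengths \<open>1,3,3\<close>, \<open>2,2,3\<close> and \<open>1,2,5\<close>, and two six-cycles with two short chords. They are found around a
  longest cycle \<open>C\<close>. If \<open>C\<close> misses a vertex, a component \<open>D\<close> of the rest attaches to \<open>C\<close> at two vertices,
  which are not consecutive because \<open>C\<close> could otherwise be extended through \<open>D\<close>. Contracting \<open>D\<close> gives a
  theta graph that saves \<open>3\<close> as soon as \<open>C\<close> has length at least \<open>5\<close>; if \<open>C\<close> has length \<open>4\<close>, maximality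
  forces every outside vertex to be adjacent to the same two opposite vertices of \<open>C\<close>, whence
  \<open>K\<^sub>2\<^sub>,\<^sub>4\<close> in order at least \<open>6\<close>. If \<open>C\<close> is Hamiltonian and \<open>G\<close> is not a cycle, any chord gives a theta graph that saves \<open>3\<close>,
  except for chords between vertices at distance two when \<open>n = 6\<close>; and if two such chords lie in different
  triangles of second neighbours, they save \<open>3\<close> together. What remains is a spanning subgraph of the
  3-sun. In order \<open>4\<close> every graph is contained in \<open>K\<^sub>4\<close>, and in order \<open>5\<close>
  the only graph not contained in \<open>K\<^sub>5 - e\<close> is \<open>K\<^sub>5\<close>, which saves \<open>3\<close>.

  Conversely, \<open>n - 3\<close> colours do not suffice for the listed graphs. Since adding edges only
  helps, it is enough to treat \<open>C\<^sub>n\<close>, the 3-sun, \<open>K\<^sub>5 - e\<close> and order \<open>4\<close>. With \<open>k\<close> colours a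
  rainbow tree has at most \<open>k + 1\<close> vertices, which settles all but \<open>C\<^sub>n\<close>; there, three repetitions of colours
  force every rainbow subgraph to miss edges in two of the three arcs cut out by a suitable triple.
\<close>



section \<open>Connectivity through edge sets\<close>

definition joined :: "'a set set \<Rightarrow> 'a \<Rightarrow> 'a \<Rightarrow> bool" where
  "joined F = (\<lambda>a b. {a, b} \<in> F)\<^sup>*\<^sup>*"

definition conn :: "'a set set \<Rightarrow> 'a set \<Rightarrow> bool" where
  "conn E X \<longleftrightarrow> (\<forall>x\<in>X. \<forall>y\<in>X. joined {e \<in> E. e \<subseteq> X} x y)"

definition touch :: "'a set set \<Rightarrow> 'a set \<Rightarrow> 'a set \<Rightarrow> bool" where
  "touch E X Y \<longleftrightarrow> (\<exists>x\<in>X. \<exists>y\<in>Y. {x, y} \<in> E)"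

definition component :: "'a set set \<Rightarrow> 'a set \<Rightarrow> 'a \<Rightarrow> 'a set" where
  "component E X x = {y. joined {e \<in> E. e \<subseteq> X} x y}"

lemma joined_refl [simp, intro]: "joined F x x"
  by (simp add: joined_def)

lemma joined_edge: "{x, y} \<in> F \<Longrightarrow> joined F x y"
  unfolding joined_def by (rule r_into_rtranclp)

lemma joined_trans: "joined F x y \<Longrightarrow> joined F y z \<Longrightarrow> joined F x z"
  unfolding joined_def by (rule rtranclp_trans)

lemma joined_sym: "joined F x y \<Longrightarrow> joined F y x"
proof -
  have "symp (\<lambda>a b. {a, b} \<in> F)" by (simp add: symp_def insert_commute)
  then have "symp (joined F)" unfolding joined_def by (rule symp_rtranclp)
  then show "joined F x y \<Longrightarrow> joined F y x" by (rule sympD)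
qed

lemma joined_mono: "F \<subseteq> F' \<Longrightarrow> joined F x y \<Longrightarrow> joined F' x y"
  unfolding joined_def by (erule rtranclp_mono[THEN predicate2D, rotated]) auto

lemma joined_induct [consumes 1, case_names refl step]:
  assumes "joined F x y" "P x"
    and "\<And>y z. joined F x y \<Longrightarrow> {y, z} \<in> F \<Longrightarrow> P y \<Longrightarrow> P z"
  shows "P y"
  using assms unfolding joined_def by (induction rule: rtranclp_induct) auto

lemma joined_crosses:
  assumes "joined F x y" "x \<in> A" "y \<notin> A"
  shows "\<exists>a\<in>A. \<exists>b. b \<notin> A \<and> {a, b} \<in> F"
proof -
  have "y \<notin> A \<longrightarrow> (\<exists>a\<in>A. \<exists>b. b \<notin> A \<and> {a, b} \<in> F)"
    using assms(1) by (induction rule: joined_induct) (use assms(2) in auto)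
  then show ?thesis using assms(3) by blast
qed

lemma conn_crosses:
  assumes "conn E X" "x \<in> X" "x \<in> A" "y \<in> X" "y \<notin> A"
  shows "\<exists>a\<in>X \<inter> A. \<exists>b\<in>X - A. {a, b} \<in> E"
proof -
  have "joined {e \<in> E. e \<subseteq> X} x y" using assms by (auto simp: conn_def)
  from joined_crosses[OF this assms(3,5)] show ?thesis by auto
qed

lemma joined_if_conn: "conn E X \<Longrightarrow> x \<in> X \<Longrightarrow> y \<in> X \<Longrightarrow> joined E x y"
  unfolding conn_def by (blast intro: joined_mono[of "{e \<in> E. e \<subseteq> X}"])

lemma conn_fromI:
  assumes "\<And>y. y \<in> X \<Longrightarrow> joined {e \<in> E. e \<subseteq> X} x y"
  shows "conn E X"
  unfolding conn_def using assms by (blast intro: joined_trans joined_sym)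

lemma conn_singleton [simp]: "conn E {x}"
  by (simp add: conn_def)

lemma touch_sym: "touch E X Y \<Longrightarrow> touch E Y X"
  unfolding touch_def by (metis insert_commute)

lemma touch_mono: "touch E X Y \<Longrightarrow> X \<subseteq> X' \<Longrightarrow> Y \<subseteq> Y' \<Longrightarrow> touch E X' Y'"
  unfolding touch_def by blast

lemma conn_Un:
  assumes "conn E X" "conn E Y" "touch E X Y"
  shows "conn E (X \<union> Y)"
proof -
  obtain x y where xy: "x \<in> X" "y \<in> Y" "{x, y} \<in> E" using assms(3) by (auto simp: touch_def)
  let ?F = "{e \<in> E. e \<subseteq> X \<union> Y}"
  have X: "joined ?F x z" if "z \<in> X" for z
    using assms(1) xy(1) that unfolding conn_def
    by (blast intro: joined_mono[of "{e \<in> E. e \<subseteq> X}"])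
  have Y: "joined ?F y z" if "z \<in> Y" for z
    using assms(2) xy(2) that unfolding conn_def
    by (blast intro: joined_mono[of "{e \<in> E. e \<subseteq> Y}"])
  have "joined ?F x y" using xy by (intro joined_edge) auto
  then show ?thesis using X Y by (intro conn_fromI[of _ _ x]) (auto intro: joined_trans)
qed

lemma self_in_component [simp, intro]: "x \<in> component E X x"
  by (simp add: component_def)

lemma component_subset:
  assumes "x \<in> X"
  shows "component E X x \<subseteq> X"
proof
  fix y assume "y \<in> component E X x"
  then have "joined {e \<in> E. e \<subseteq> X} x y" by (simp add: component_def)
  then show "y \<in> X" by (induction rule: joined_induct) (use assms in auto)
qed

lemma component_closed:
  assumes "x \<in> X" "a \<in> component E X x" "b \<in> X" "{a, b} \<in> E"
  shows "b \<in> component E X x"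
proof -
  have "a \<in> X" using component_subset assms(1,2) by fast
  then have "joined {e \<in> E. e \<subseteq> X} a b" using assms by (intro joined_edge) auto
  then show ?thesis using assms(2) by (auto simp: component_def intro: joined_trans)
qed

lemma conn_component:
  assumes "x \<in> X"
  shows "conn E (component E X x)"
proof (rule conn_fromI[of _ _ x])
  fix y assume "y \<in> component E X x"
  then have "joined {e \<in> E. e \<subseteq> X} x y" by (simp add: component_def)
  then show "joined {e \<in> E. e \<subseteq> component E X x} x y"
  proof (induction rule: joined_induct)
    case (step y z)
    have "y \<in> component E X x" using step.hyps by (simp add: component_def)
    moreover have "z \<in> component E X x"
      using component_closed[OF assms calculation] step.hyps by blast
    ultimately show ?case using step by (blast intro: joined_trans joined_edge)
  qed simp
qed

text \<open>The form in which connectivity is used: an edge leaving a component of \<open>V - C\<close> inside a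
  connected set \<open>W\<close> can only end in \<open>C\<close>. Taking for \<open>W\<close> the whole vertex set, or that set minus one vertex,
  produces the attachments of the component.\<close>

lemma component_leaves:
  assumes "conn E W" "D = component E (V - C) d" "d \<in> V - C" "D \<subseteq> W" "W \<subseteq> V"
    and "w \<in> W" "w \<notin> D"
  shows "\<exists>b\<in>C \<inter> W. touch E D {b}"
proof -
  have "d \<in> D" using assms(2) by simp
  then have "d \<in> W" using assms(4) by blast
  from conn_crosses[OF assms(1) this \<open>d \<in> D\<close> assms(6,7)]
  obtain a b where ab: "a \<in> D" "b \<in> W" "b \<notin> D" "{a, b} \<in> E" by blast
  then have "b \<notin> V - C" using component_closed[OF assms(3)] assms(2) by metis
  then show ?thesis using ab assms(5) by (auto simp: touch_def)
qed

text \<open>One part is the component of \<open>x\<close> after the deletion of \<open>y\<close>, the other is \<open>{y}\<close> itself.\<close>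

lemma conn_split:
  assumes "conn E X" "x \<in> X" "y \<in> X" "x \<noteq> y"
  shows "\<exists>P Q. P \<subseteq> X \<and> Q \<subseteq> X \<and> P \<inter> Q = {} \<and> conn E P \<and> conn E Q \<and>
    x \<in> P \<and> y \<in> Q \<and> touch E P Q"
proof -
  let ?P = "component E (X - {y}) x"
  have x: "x \<in> X - {y}" using assms by auto
  have sub: "?P \<subseteq> X - {y}" using component_subset[OF x] .
  have "touch E ?P {y}" using component_leaves[OF assms(1) refl x, of y] sub assms(3) by blast
  then show ?thesis using conn_component[OF x] sub assms(3)
    by (intro exI[of _ ?P] exI[of _ "{y}"]) auto
qed

text \<open>A spanning tree, known only through its number of edges. It is grown from one vertex; each new
  edge leaves the part reached so far, hence is new.\<close>

lemma conn_spanning_edges: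
  assumes "finite W" "conn E W" "W \<noteq> {}"
  shows "\<exists>F\<subseteq>E. F \<subseteq> Pow W \<and> finite F \<and> card F = card W - 1 \<and>
    (\<forall>x\<in>W. \<forall>y\<in>W. joined F x y)"
proof -
  have "\<exists>R F. R \<subseteq> W \<and> card R = Suc m \<and> F \<subseteq> E \<and> F \<subseteq> Pow R \<and> finite F \<and> card F = m \<and>
      (\<forall>x\<in>R. \<forall>y\<in>R. joined F x y)" if "Suc m \<le> card W" for m
    using that
  proof (induction m)
    case 0
    obtain w where "w \<in> W" using assms(3) by blast
    then show ?case by (intro exI[of _ "{w}"] exI[of _ "{}"]) auto
  next
    case (Suc m)
    then obtain R F where RF: "R \<subseteq> W" "card R = Suc m" "F \<subseteq> E" "F \<subseteq> Pow R" "finite F"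
      "card F = m" "\<And>x y. x \<in> R \<Longrightarrow> y \<in> R \<Longrightarrow> joined F x y" by (auto dest: Suc_leD)
    have fR: "finite R" using RF(1) assms(1) finite_subset by blast
    have "R \<noteq> W" using RF(2) Suc.prems by auto
    then obtain y where y: "y \<in> W" "y \<notin> R" using RF(1) by blast
    obtain x where x: "x \<in> R" using RF(2) by fastforce
    have "x \<in> W" using x RF(1) by blast
    from conn_crosses[OF assms(2) this x y]
    obtain a b where ab: "a \<in> R" "b \<in> W" "b \<notin> R" "{a, b} \<in> E" by blast
    let ?F = "insert {a, b} F"
    have "joined ?F a x" if "x \<in> R" for x
      using RF(7)[OF ab(1) that] by (rule joined_mono[rotated]) blast
    moreover have "joined ?F a b" by (rule joined_edge) simp
    ultimately have "joined ?F a x" if "x \<in> insert b R" for x using that by blast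
    then have "\<forall>x\<in>insert b R. \<forall>y\<in>insert b R. joined ?F x y"
      by (meson joined_sym joined_trans)
    moreover have "card ?F = Suc m" using RF(4,5,6) ab(3) by (subst card_insert_disjoint) auto
    moreover have "card (insert b R) = Suc (Suc m)" using fR ab(3) RF(2) by simp
    moreover have "?F \<subseteq> E" "?F \<subseteq> Pow (insert b R)" "finite ?F" "insert b R \<subseteq> W"
      using RF ab by auto
    ultimately show ?case by (intro exI[of _ "insert b R"] exI[of _ ?F]) blast
  qed
  moreover have "Suc (card W - 1) = card W" using assms(1,3) by (simp add: card_gt_0_iff)
  ultimately obtain R F where RF: "R \<subseteq> W" "card R = card W" "F \<subseteq> E"
    "F \<subseteq> Pow R" "finite F" "card F = card W - 1" "\<forall>x\<in>R. \<forall>y\<in>R. joined F x y"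
    by (metis order_refl)
  have "R = W" by (rule card_subset_eq[OF assms(1) RF(1,2)])
  then show ?thesis using RF by blast
qed


section \<open>Rainbow-linked triples\<close>

text \<open>That \<open>k\<close> colours suffice, with trees replaced by arbitrary rainbow edge sets that link the
  triple. This relieves all later constructions from checking acyclicity.\<close>

definition colorable :: "'a set \<Rightarrow> 'a set set \<Rightarrow> nat \<Rightarrow> bool" where
  "colorable V E k \<longleftrightarrow> (\<exists>c :: 'a set \<Rightarrow> nat. c ` E \<subseteq> {..<k} \<and>
     (\<forall>S. S \<subseteq> V \<and> card S = 3 \<longrightarrow>
        (\<exists>F\<subseteq>E. inj_on c F \<and> (\<forall>x\<in>S. \<forall>y\<in>S. joined F x y))))"

lemma adj_rtranclp: "(adj G)\<^sup>*\<^sup>* = joined (edges G)"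
  by (simp add: joined_def adj_def[abs_def])

lemma simple_graph_edge:
  assumes "simple_graph G" "{x, y} \<in> edges G"
  shows "x \<in> verts G" "y \<in> verts G" "x \<noteq> y"
proof -
  have *: "{x, y} \<subseteq> verts G" "card {x, y} = 2" using assms by (auto simp: simple_graph_def)
  then show "x \<in> verts G" "y \<in> verts G" by auto
  show "x \<noteq> y" using *(2) by auto
qed

lemma simple_graph_edgeE:
  assumes "simple_graph G" "e \<in> edges G"
  obtains x y where "e = {x, y}" "x \<noteq> y" "x \<in> verts G" "y \<in> verts G"
  using assms by (auto simp: simple_graph_def card_2_iff)

lemma finite_edges: "simple_graph G \<Longrightarrow> finite (edges G)"
  unfolding simple_graph_def by (meson PowI finite_Pow_iff finite_subset subsetI)

lemma cycle_edge_removable: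
  assumes "is_cycle (W, F) vs" "joined F x y"
  shows "joined (F - {{last vs, hd vs}}) x y"
proof -
  let ?n = "length vs" and ?F = "F - {{last vs, hd vs}}"
  have vs: "3 \<le> ?n" "distinct vs" "\<And>i. i < ?n \<Longrightarrow> {vs ! i, vs ! (Suc i mod ?n)} \<in> F"
    using assms(1) by (auto simp: is_cycle_def adj_def)
  have ends: "last vs = vs ! (?n - 1)" "hd vs = vs ! 0"
    using vs(1) by (cases "vs = []"; simp add: last_conv_nth hd_conv_nth)+
  have edge: "{vs ! i, vs ! Suc i} \<in> ?F" if "Suc i < ?n" for i
  proof -
    have "{vs ! i, vs ! Suc i} \<in> F" using vs(3)[of i] that by simp
    moreover have "{vs ! i, vs ! Suc i} \<noteq> {last vs, hd vs}"
      using that vs(1,2) nth_eq_iff_index_eq[OF vs(2)] unfolding ends doubleton_eq_iff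
      by (smt (verit) One_nat_def Suc_eq_numeral Suc_lessD Suc_pred diff_Suc_1 le_0_eq less_Suc_eq
          nat_less_le not_less_eq numeral_3_eq_3 zero_less_Suc)
    ultimately show ?thesis by simp
  qed
  have path: "joined ?F (vs ! 0) (vs ! i)" if "i < ?n" for i
    using that
  proof (induction i)
    case (Suc i)
    then show ?case using edge[of i] by (blast intro: joined_trans joined_edge dest: Suc_lessD)
  qed simp
  have "0 < ?n" using vs(1) by linarith
  then have "joined ?F (hd vs) (last vs)" using path[of "?n - 1"] ends by simp
  note closing = this joined_sym[OF this]
  show ?thesis using assms(2)
  proof (induction rule: joined_induct)
    case (step y z)
    have "joined ?F y z"
    proof (cases "{y, z} = {last vs, hd vs}")
      case True
      then show ?thesis using closing unfolding doubleton_eq_iff by blast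
    next
      case False
      then show ?thesis using step.hyps(2) by (intro joined_edge) blast
    qed
    with step.IH show ?case by (rule joined_trans)
  qed simp
qed

text \<open>From right to left, a linking edge set with as few edges as possible is a tree: an edge outside
  the component of \<open>S\<close> or on a cycle could be dropped.\<close>

lemma rainbow_S_tree_iff:
  assumes G: "simple_graph G" and S: "S \<subseteq> verts G" "S \<noteq> {}"
  shows "(\<exists>T. rainbow_S_tree c G S T) \<longleftrightarrow>
    (\<exists>F\<subseteq>edges G. inj_on c F \<and> (\<forall>x\<in>S. \<forall>y\<in>S. joined F x y))" (is "?L \<longleftrightarrow> ?R")
proof
  assume ?L
  then obtain T where T: "edges T \<subseteq> edges G" "inj_on c (edges T)" "S \<subseteq> verts T"
    "connected_graph T"
    unfolding rainbow_S_tree_def rainbow_tree_def is_tree_def subgraph_def by auto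
  then show ?R unfolding connected_graph_def adj_rtranclp
    by (intro exI[of _ "edges T"]) (meson subsetD)
next
  assume ?R
  then obtain F0 where F0: "F0 \<subseteq> edges G" "inj_on c F0" "\<forall>x\<in>S. \<forall>y\<in>S. joined F0 x y" by blast
  define P where "P F \<longleftrightarrow> F \<subseteq> F0 \<and> (\<forall>x\<in>S. \<forall>y\<in>S. joined F x y)" for F
  have "P F0" using F0(3) by (simp add: P_def)
  then have "\<exists>F. P F \<and> (\<forall>F'. P F' \<longrightarrow> card F \<le> card F')" by (rule ex_has_least_nat)
  then obtain F where PF: "P F" and min: "\<And>F'. P F' \<Longrightarrow> card F \<le> card F'" by blast
  have F: "F \<subseteq> F0" "\<And>x y. x \<in> S \<Longrightarrow> y \<in> S \<Longrightarrow> joined F x y" using PF by (auto simp: P_def)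
  have fin: "finite F" using F F0(1) finite_edges[OF G] finite_subset by metis
  have FE: "F \<subseteq> edges G" using F F0 by blast
  obtain s where s: "s \<in> S" using S by blast
  define W where "W = component F UNIV s"
  have W: "W = {y. joined F s y}" by (simp add: W_def component_def)
  have SW: "S \<subseteq> W" using F s by (auto simp: W)
  \<comment> \<open>By minimality no edge lies outside the component of \<open>S\<close>.\<close>
  have conW: "conn F W" unfolding W_def by (rule conn_component) simp
  then have "P {e \<in> F. e \<subseteq> W}" using F(1) SW unfolding P_def conn_def by blast
  then have "{e \<in> F. e \<subseteq> W} = F" using min fin by (simp add: card_seteq)
  then have FW: "\<And>e. e \<in> F \<Longrightarrow> e \<subseteq> W" by auto
  have sV: "s \<in> verts G" using s S by auto
  have WV: "W \<subseteq> verts G"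
  proof
    fix y assume "y \<in> W"
    then have "joined F s y" by (simp add: W)
    then show "y \<in> verts G"
      by (induction rule: joined_induct) (use simple_graph_edge[OF G] FE sV in auto)
  qed
  let ?T = "(W, F)"
  have simp: "simple_graph ?T" using G FE FW WV unfolding simple_graph_def
    by (auto intro: finite_subset)
  have con: "connected_graph ?T"
    using conW s SW by (auto simp: connected_graph_def adj_rtranclp intro: joined_if_conn)
  have acyc: "\<not> is_cycle ?T vs" for vs
  proof
    assume cyc: "is_cycle ?T vs"
    let ?e = "{last vs, hd vs}"
    have "P (F - {?e})" using F cycle_edge_removable[OF cyc] unfolding P_def by blast
    then have "card F \<le> card (F - {?e})" by (rule min)
    then have "?e \<notin> F" using fin by (metis card_Diff1_less leD)
    moreover have "?e \<in> F"
    proof -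
      have *: "3 \<le> length vs" "\<And>i. i < length vs \<Longrightarrow> {vs ! i, vs ! (Suc i mod length vs)} \<in> F"
        using cyc by (auto simp: is_cycle_def adj_def)
      from *(1) have "vs \<noteq> []" by auto
      then show ?thesis using *(2)[of "length vs - 1"] *(1)
        by (simp add: last_conv_nth hd_conv_nth)
    qed
    ultimately show False by simp
  qed
  have "rainbow_S_tree c G S ?T"
    unfolding rainbow_S_tree_def rainbow_tree_def is_tree_def subgraph_def
    using simp con acyc SW WV FE F F0(2) by (auto intro: inj_on_subset)
  then show ?L ..
qed

lemma three_rainbow_colorable:
  assumes "simple_graph G"
  shows "(\<exists>c :: 'a set \<Rightarrow> nat. c ` edges G \<subseteq> {..<k} \<and> three_rainbow_coloring c G)
    \<longleftrightarrow> colorable (verts G) (edges G) k"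
proof -
  have "three_rainbow_coloring c G \<longleftrightarrow> (\<forall>S. S \<subseteq> verts G \<and> card S = 3 \<longrightarrow>
        (\<exists>F\<subseteq>edges G. inj_on c F \<and> (\<forall>x\<in>S. \<forall>y\<in>S. joined F x y)))" for c :: "'a set \<Rightarrow> nat"
    unfolding three_rainbow_coloring_def
    using rainbow_S_tree_iff[OF assms, of _ c] by (metis card.empty zero_neq_numeral)
  then show ?thesis by (simp add: colorable_def)
qed

lemma rx3_le:
  assumes "simple_graph G" "colorable (verts G) (edges G) k"
  shows "rx3 G \<le> k"
  unfolding rx3_def three_rainbow_colorable[OF assms(1)] using assms(2) by (rule Least_le)

lemma colorable_rx3:
  assumes "simple_graph G" "colorable (verts G) (edges G) k"
  shows "colorable (verts G) (edges G) (rx3 G)"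
  unfolding rx3_def three_rainbow_colorable[OF assms(1)] using assms(2) by (rule LeastI)

lemma colorable_mono: "colorable V E k \<Longrightarrow> k \<le> m \<Longrightarrow> colorable V E m"
  unfolding colorable_def by (meson lessThan_subset_iff order_trans)


section \<open>Branch sets\<close>

definition branch_sets :: "'a set \<Rightarrow> 'a set set \<Rightarrow> 'b set \<Rightarrow> ('b \<Rightarrow> 'a set) \<Rightarrow> bool" where
  "branch_sets V E W B \<longleftrightarrow>
     (\<forall>w\<in>W. B w \<noteq> {} \<and> B w \<subseteq> V \<and> conn E (B w)) \<and>
     (\<forall>u\<in>W. \<forall>w\<in>W. u \<noteq> w \<longrightarrow> B u \<inter> B w = {})"

text \<open>The graph with vertex set \<open>W\<close> and edge set \<open>D\<close> is a minor of the graph with vertex set \<open>V\<close> and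
  edge set \<open>E\<close>: the disjoint connected sets \<open>B w\<close> contract to the vertices \<open>w\<close>.\<close>

definition minor_model ::
  "'a set \<Rightarrow> 'a set set \<Rightarrow> 'b set \<Rightarrow> 'b set set \<Rightarrow> ('b \<Rightarrow> 'a set) \<Rightarrow> bool" where
  "minor_model V E W D B \<longleftrightarrow> branch_sets V E W B \<and>
     (\<forall>e\<in>D. \<exists>u w. e = {u, w} \<and> u \<in> W \<and> w \<in> W \<and> u \<noteq> w \<and> touch E (B u) (B w))"

lemma branch_setsD:
  assumes "branch_sets V E W B" "w \<in> W"
  shows "B w \<noteq> {}" "B w \<subseteq> V" "conn E (B w)"
  using assms by (auto simp: branch_sets_def)

lemma branch_sets_eq:
  assumes "branch_sets V E W B" "u \<in> W" "w \<in> W" "x \<in> B u" "x \<in> B w"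
  shows "u = w"
  using assms unfolding branch_sets_def by blast

lemma minor_model_mono:
  assumes "minor_model V E W D B" "branch_sets V E W B'" "\<And>w. w \<in> W \<Longrightarrow> B w \<subseteq> B' w"
  shows "minor_model V E W D B'"
  using assms unfolding minor_model_def by (metis touch_mono)

text \<open>In a connected graph the vertices outside the branch sets can be absorbed one at a time by a
  branch set that they touch.\<close>

lemma branch_sets_extend:
  assumes "finite V" "conn E V" "W \<noteq> {}" "branch_sets V E W B"
  shows "\<exists>B'. branch_sets V E W B' \<and> (\<forall>w\<in>W. B w \<subseteq> B' w) \<and> (\<Union>w\<in>W. B' w) = V"
  using assms(4)
proof (induction "card (V - (\<Union>w\<in>W. B w))" arbitrary: B rule: less_induct)
  case less
  let ?U = "\<Union>w\<in>W. B w"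
  show ?case
  proof (cases "?U = V")
    case False
    have sub: "?U \<subseteq> V" using branch_setsD(2)[OF less.prems] by blast
    then obtain y where y: "y \<in> V" "y \<notin> ?U" using False by blast
    obtain w x where "w \<in> W" "x \<in> B w" using assms(3) branch_setsD(1)[OF less.prems] by blast
    then have x: "x \<in> ?U" "x \<in> V" using sub by auto
    from conn_crosses[OF assms(2) x(2,1) y]
    obtain a b where ab: "a \<in> ?U" "b \<in> V" "b \<notin> ?U" "{a, b} \<in> E" by blast
    then obtain w where w: "w \<in> W" "a \<in> B w" by blast
    let ?B = "B(w := B w \<union> {b})"
    have "conn E (B w \<union> {b})"
      using branch_setsD(3)[OF less.prems w(1)] w(2) ab(4) by (intro conn_Un) (auto simp: touch_def)
    then have bs: "branch_sets V E W ?B"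
      using less.prems ab(2,3) w(1) unfolding branch_sets_def by auto
    have "(\<Union>w\<in>W. ?B w) = insert b ?U" using w(1) by auto
    moreover have "V - insert b ?U \<subset> V - ?U" using ab(2,3) by auto
    ultimately have "card (V - (\<Union>w\<in>W. ?B w)) < card (V - ?U)"
      using assms(1) by (simp add: psubset_card_mono)
    from less.hyps[OF this bs] show ?thesis by (metis Un_upper1 fun_upd_apply order_trans)
  qed (use less.prems in auto)
qed

text \<open>The saving \<open>card V - k\<close> is inherited from minors. Branch sets that exhaust \<open>V\<close> have spanning
  trees with \<open>card V - card W\<close> edges in total; with new colours on these, a rainbow edge set of the minor lifts to
  one that links any two vertices whose branch sets were linked.\<close>

lemma colorable_minor:
  fixes V :: "'a set" and W :: "'b set"
  assumes V: "finite V" "conn E V" and W: "finite W" "3 \<le> card W"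
    and model: "minor_model V E W D B0" and col: "colorable W D k"
  shows "colorable V E (k + (card V - card W))"
proof -
  have "W \<noteq> {}" "branch_sets V E W B0" using W model by (auto simp: minor_model_def)
  from branch_sets_extend[OF V this]
  obtain B where B: "branch_sets V E W B" "\<forall>w\<in>W. B0 w \<subseteq> B w" and UB: "(\<Union>w\<in>W. B w) = V"
    by (elim exE conjE)
  have model: "minor_model V E W D B" using minor_model_mono[OF model B(1)] B(2) by blast
  have finB: "finite (B w)" if "w \<in> W" for w
    using branch_setsD(2)[OF B(1) that] V(1) finite_subset by blast
  have "\<forall>x\<in>V. \<exists>w. w \<in> W \<and> x \<in> B w" using UB by blast
  from bchoice[OF this] obtain f where "\<forall>x\<in>V. f x \<in> W \<and> x \<in> B (f x)" ..
  then have f: "\<And>x. x \<in> V \<Longrightarrow> f x \<in> W" "\<And>x. x \<in> V \<Longrightarrow> x \<in> B (f x)" by auto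
  have f_eq: "f x = w" if "w \<in> W" "x \<in> B w" for x w
    using branch_sets_eq[OF B(1) _ that(1) _ that(2)] f branch_setsD(2)[OF B(1) that(1)] that(2)
    by blast
  obtain c where c: "c ` D \<subseteq> {..<k}"
    "\<And>S. S \<subseteq> W \<Longrightarrow> card S = 3 \<Longrightarrow> \<exists>F\<subseteq>D. inj_on c F \<and> (\<forall>x\<in>S. \<forall>y\<in>S. joined F x y)"
    using col unfolding colorable_def by auto
  \<comment> \<open>A spanning tree inside every branch set; these edges receive pairwise distinct new colours.\<close>
  have "\<forall>w\<in>W. \<exists>T\<subseteq>E. T \<subseteq> Pow (B w) \<and> finite T \<and> card T = card (B w) - 1 \<and>
      (\<forall>x\<in>B w. \<forall>y\<in>B w. joined T x y)"
    using conn_spanning_edges[OF finB branch_setsD(3)[OF B(1)] branch_setsD(1)[OF B(1)]] by simp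
  from bchoice[OF this] obtain T where "\<forall>w\<in>W. T w \<subseteq> E \<and> T w \<subseteq> Pow (B w) \<and> finite (T w) \<and>
      card (T w) = card (B w) - 1 \<and> (\<forall>x\<in>B w. \<forall>y\<in>B w. joined (T w) x y)" ..
  then have T: "\<And>w. w \<in> W \<Longrightarrow> T w \<subseteq> E" "\<And>w. w \<in> W \<Longrightarrow> T w \<subseteq> Pow (B w)"
    "\<And>w. w \<in> W \<Longrightarrow> finite (T w)" "\<And>w. w \<in> W \<Longrightarrow> card (T w) = card (B w) - 1"
    "\<And>w x y. w \<in> W \<Longrightarrow> x \<in> B w \<Longrightarrow> y \<in> B w \<Longrightarrow> joined (T w) x y"
    by simp_all
  define F0 where "F0 = (\<Union>w\<in>W. T w)"
  have finF0: "finite F0" using W(1) T(3) by (auto simp: F0_def)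
  have "card F0 \<le> (\<Sum>w\<in>W. card (T w))" unfolding F0_def by (rule card_UN_le[OF W(1)])
  also have "\<dots> = (\<Sum>w\<in>W. card (B w) - 1)" using T(4) by simp
  also have "\<dots> = (\<Sum>w\<in>W. card (B w)) - (\<Sum>w\<in>W. 1)"
    using finB branch_setsD(1)[OF B(1)] by (intro sum_subtractf_nat) (simp add: Suc_le_eq card_gt_0_iff)
  also have "(\<Sum>w\<in>W. card (B w)) = card V"
    unfolding UB[symmetric] using W(1) finB B(1)
    by (intro card_UN_disjoint[symmetric]) (auto simp: branch_sets_def)
  finally have cardF0: "card F0 \<le> card V - card W" by simp
  obtain g where g: "inj_on g F0" "g ` F0 = {0..<card F0}"
    using ex_bij_betw_finite_nat[OF finF0] by (auto simp: bij_betw_def)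
  have F0_image: "\<exists>w. f ` e \<subseteq> {w}" if "e \<in> F0" for e
    using that T(2) f_eq unfolding F0_def by fastforce
  have "\<forall>e\<in>D. \<exists>d. d \<in> E \<and> f ` d = e \<and> (\<exists>x y. d = {x, y} \<and> x \<in> V \<and> y \<in> V)"
  proof
    fix e assume "e \<in> D"
    then obtain u w where uw: "e = {u, w}" "u \<in> W" "w \<in> W" "touch E (B u) (B w)"
      using model unfolding minor_model_def by blast
    then obtain x y where xy: "x \<in> B u" "y \<in> B w" "{x, y} \<in> E" by (auto simp: touch_def)
    then have "x \<in> V" "y \<in> V" using branch_setsD(2)[OF B(1)] uw by auto
    then show "\<exists>d. d \<in> E \<and> f ` d = e \<and> (\<exists>x y. d = {x, y} \<and> x \<in> V \<and> y \<in> V)"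
      using f_eq[OF uw(2) xy(1)] f_eq[OF uw(3) xy(2)] uw(1) xy(3)
      by (intro exI[of _ "{x, y}"]) auto
  qed
  from bchoice[OF this] obtain l where "\<forall>e\<in>D. l e \<in> E \<and> f ` l e = e \<and>
      (\<exists>x y. l e = {x, y} \<and> x \<in> V \<and> y \<in> V)" ..
  then have l: "\<And>e. e \<in> D \<Longrightarrow> l e \<in> E" "\<And>e. e \<in> D \<Longrightarrow> f ` l e = e"
    "\<And>e. e \<in> D \<Longrightarrow> \<exists>x y. l e = {x, y} \<and> x \<in> V \<and> y \<in> V"
    by simp_all
  have l_F0: "l e \<notin> F0" if e: "e \<in> D" for e
  proof
    assume "l e \<in> F0"
    from F0_image[OF this] obtain z where "e \<subseteq> {z}" unfolding l(2)[OF e] ..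
    moreover obtain u w where "e = {u, w}" "u \<noteq> w"
      using model e unfolding minor_model_def by metis
    ultimately show False by auto
  qed
  \<comment> \<open>The remaining edges may have any of the colours; \<open>0\<close> is one because \<open>0 < k\<close>.\<close>
  define c' where "c' d = (if d \<in> F0 then k + g d else if d \<in> l ` D then c (f ` d) else 0)" for d
  have c'_l: "c' (l e) = c e" if "e \<in> D" for e using that l_F0 l(2) by (auto simp: c'_def)
  have c'_F0: "c' d = k + g d" if "d \<in> F0" for d using that by (simp add: c'_def)
  have "0 < k"
  proof -
    obtain S where S: "S \<subseteq> W" "card S = 3" by (rule obtain_subset_with_card_n[OF W(2)])
    from S(2) obtain x y where xy: "x \<in> S" "y \<in> S" "x \<noteq> y" by (auto simp: card_3_iff)
    obtain F where "F \<subseteq> D" "joined F x y" using c(2)[OF S] xy by blast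
    then have "D \<noteq> {}" using joined_crosses[of F x y "{x}"] xy(3) by auto
    then show ?thesis using c(1) by auto
  qed
  have "c' d < k + (card V - card W)" for d
  proof -
    consider "d \<in> F0" | e where "e \<in> D" "d = l e" | "d \<notin> F0" "d \<notin> l ` D" by blast
    then show ?thesis
    proof cases
      case 1
      then have "g d < card F0" using g(2) by (metis atLeastLessThan_iff imageI)
      then show ?thesis using c'_F0[OF 1] cardF0 by simp
    next
      case 2
      then have "c e < k" using c(1) by auto
      then show ?thesis using c'_l 2 by simp
    qed (use \<open>0 < k\<close> in \<open>simp add: c'_def\<close>)
  qed
  then have range: "c' ` E \<subseteq> {..<k + (card V - card W)}" by auto
  have "\<exists>F\<subseteq>E. inj_on c' F \<and> (\<forall>x\<in>S. \<forall>y\<in>S. joined F x y)" if S: "S \<subseteq> V" "card S = 3" for S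
  proof -
    have "finite S" using S(1) V(1) finite_subset by blast
    then have "card (f ` S) \<le> 3" using S(2) card_image_le by metis
    moreover have "f ` S \<subseteq> W" using f(1) S(1) by blast
    ultimately have "\<exists>S'. f ` S \<subseteq> S' \<and> S' \<subseteq> W \<and> card S' = 3"
      using W by (intro exists_subset_between)
    then obtain S' where S': "f ` S \<subseteq> S'" "S' \<subseteq> W" "card S' = 3" by (elim exE conjE)
    obtain F where F: "F \<subseteq> D" "inj_on c F" "\<And>x y. x \<in> S' \<Longrightarrow> y \<in> S' \<Longrightarrow> joined F x y"
      using c(2)[OF S'(2,3)] by blast
    let ?F = "l ` F \<union> F0"
    have inside: "joined ?F x y" if "w \<in> W" "x \<in> B w" "y \<in> B w" for x y w
      using T(5)[OF that] by (rule joined_mono[rotated]) (use that F0_def in blast)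
    have lift: "u \<in> W \<longrightarrow> w \<in> W \<and> (\<forall>x\<in>B u. \<forall>y\<in>B w. joined ?F x y)" if "joined F u w" for u w
      using that
    proof (induction rule: joined_induct)
      case (step v w)
      show ?case
      proof
        assume u: "u \<in> W"
        have e: "{v, w} \<in> D" using step.hyps F(1) by blast
        obtain x y where xy: "l {v, w} = {x, y}" "x \<in> V" "y \<in> V" using l(3)[OF e] by blast
        then have "{f x, f y} = {v, w}" using l(2)[OF e] by simp
        then consider "f x = v" "f y = w" | "f x = w" "f y = v"
          unfolding doubleton_eq_iff by blast
        then obtain x y where xy: "l {v, w} = {x, y}" "x \<in> V" "y \<in> V" "f x = v" "f y = w"
        proof cases
          case 2
          then show thesis using xy by (intro that[of y x]) auto
        qed (use xy in \<open>rule that\<close>)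
        have vw: "v \<in> W" "w \<in> W" "x \<in> B v" "y \<in> B w" using f xy by auto
        have "joined ?F x y" using xy(1) step.hyps(2) by (intro joined_edge) (metis UnI1 imageI)
        then show "w \<in> W \<and> (\<forall>x\<in>B u. \<forall>y\<in>B w. joined ?F x y)"
          using step.IH u vw inside[OF vw(2,4)] joined_trans by metis
      qed
    qed (use inside in blast)
    have "joined ?F x y" if "x \<in> S" "y \<in> S" for x y
      using lift[OF F(3)[of "f x" "f y"]] S'(1) f S(1) that by blast
    moreover have "inj_on c' ?F"
    proof (rule inj_on_Un[THEN iffD2], intro conjI)
      show "inj_on c' (l ` F)"
        using F(1,2) c'_l by (auto simp: inj_on_def subset_iff)
      show "inj_on c' F0" using g(1) by (simp add: inj_on_def c'_F0)
      show "c' ` (l ` F - F0) \<inter> c' ` (F0 - l ` F) = {}"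
      proof -
        have small: "c' (l e) < k" if "e \<in> F" for e using that F(1) c(1) c'_l by (auto simp: subset_iff)
        have large: "k \<le> c' d" if "d \<in> F0" for d using c'_F0[OF that] by simp
        have "c' (l e) \<noteq> c' d" if "e \<in> F" "d \<in> F0" for e d
          using small[OF that(1)] large[OF that(2)] by simp
        then show ?thesis by auto
      qed
    qed
    moreover have "?F \<subseteq> E" using l(1) F(1) T(1) by (auto simp: F0_def)
    ultimately show ?thesis by (intro exI[of _ ?F]) simp
  qed
  then show ?thesis unfolding colorable_def using range by (intro exI[of _ c']) simp
qed

text \<open>The case of branch sets with one vertex each: additional edges do no harm.\<close>

lemma colorable_embed:
  assumes "finite V" "conn E V" "3 \<le> card V" and W: "finite W" and "bij_betw f W V"
    and D: "\<And>e. e \<in> D \<Longrightarrow> \<exists>u w. e = {u, w} \<and> u \<in> W \<and> w \<in> W \<and> u \<noteq> w \<and> {f u, f w} \<in> E"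
    and "colorable W D k"
  shows "colorable V E k"
proof -
  have "branch_sets V E W (\<lambda>w. {f w})"
    using assms(5) by (auto simp: branch_sets_def bij_betw_def inj_on_def)
  then have "minor_model V E W D (\<lambda>w. {f w})"
    using D by (simp add: minor_model_def touch_def)
  moreover have "card W = card V" using bij_betw_same_card[OF assms(5)] .
  ultimately show ?thesis
    using colorable_minor[OF assms(1,2) W _ _ assms(7)] assms(3) by simp
qed

section \<open>Small graphs with an explicit colouring\<close>

type_synonym coloured_graph = "((nat \<times> nat) \<times> nat) list"

text \<open>A coloured graph is a list of entries \<open>((u, w), i)\<close> with \<open>u < w\<close>, meaning an edge \<open>{u, w}\<close> of
  colour \<open>i\<close>. Ordering the ends gives every edge a single representation.\<close>

definition edge_set :: "coloured_graph \<Rightarrow> nat set set" where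
  "edge_set L = {{u, w} | u w i. ((u, w), i) \<in> set L}"

text \<open>Each edge of the list meets \<open>R\<close> or an earlier edge, so the listed edges and \<open>R\<close> stay in one piece.\<close>

fun grows :: "nat list \<Rightarrow> (nat \<times> nat) list \<Rightarrow> bool" where
  "grows R [] \<longleftrightarrow> True"
| "grows R ((u, w) # t) \<longleftrightarrow> (u \<in> set R \<or> w \<in> set R) \<and> grows (u # w # R) t"

definition tree_verts :: "(nat \<times> nat) list \<Rightarrow> nat list" where
  "tree_verts t = concat (map (\<lambda>(u, w). [u, w]) t)"

definition rainbow_list :: "coloured_graph \<Rightarrow> (nat \<times> nat) list \<Rightarrow> bool" where
  "rainbow_list L t \<longleftrightarrow> list_all (\<lambda>e. map_of L e \<noteq> None) t \<and>
     distinct (map (\<lambda>e. the (map_of L e)) t) \<and> grows [fst (hd t)] t"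

definition covers_triples :: "nat \<Rightarrow> (nat \<times> nat) list list \<Rightarrow> bool" where
  "covers_triples m ts \<longleftrightarrow>
     list_all (\<lambda>x. list_all (\<lambda>y. list_all (\<lambda>z.
       list_ex (\<lambda>vs. x \<in> set vs \<and> y \<in> set vs \<and> z \<in> set vs) (map tree_verts ts))
     [0..<m]) [0..<m]) [0..<m]"

text \<open>Evidence, checkable by evaluation, that \<open>k\<close> colours suffice for the graph on \<open>0, ..., m - 1\<close>.\<close>

definition certificate ::
  "nat \<Rightarrow> nat \<Rightarrow> coloured_graph \<Rightarrow> (nat \<times> nat) list list \<Rightarrow> bool" where
  "certificate m k L ts \<longleftrightarrow> list_all (\<lambda>((u, w), i). u < w \<and> w < m \<and> i < k) L \<and>
     list_all (rainbow_list L) ts \<and> covers_triples m ts"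

lemma grows_joined:
  assumes "grows R t" "\<And>x. x \<in> set R \<Longrightarrow> joined F r x" "\<And>u w. (u, w) \<in> set t \<Longrightarrow> {u, w} \<in> F"
    and "x \<in> set R \<union> set (tree_verts t)"
  shows "joined F r x"
  using assms
proof (induction R t rule: grows.induct)
  case (2 R u w t)
  have e: "joined F u w" using 2(4) by (auto intro: joined_edge)
  from 2(2) consider "u \<in> set R" | "w \<in> set R" by auto
  then have "joined F r u" "joined F r w"
    using 2(3)[of u] 2(3)[of w] joined_trans[of F r] e joined_sym[OF e] by (cases; blast)+
  then show ?case using 2 by (auto simp: tree_verts_def)
qed (simp add: tree_verts_def)

lemma colorable_certificate:
  assumes "certificate m k L ts"
  shows "colorable {..<m} (edge_set L) k"
proof -
  have L: "u < w" "w < m" "i < k" if "((u, w), i) \<in> set L" for u w i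
    using that assms by (auto simp: certificate_def list_all_iff)
  have ts: "rainbow_list L t" if "t \<in> set ts" for t
    using that assms by (auto simp: certificate_def list_all_iff)
  \<comment> \<open>\<open>Min\<close> and \<open>Max\<close> recover the ordered pair under which an edge is stored.\<close>
  define c where "c e = the (map_of L (Min e, Max e))" for e
  have L_Some: "\<exists>i. map_of L (u, w) = Some i" if "((u, w), j) \<in> set L" for u w j
    using that by (metis map_of_eq_None_iff image_eqI fst_conv not_Some_eq)
  have c: "c {u, w} = the (map_of L (u, w))" if "u < w" for u w
    using that by (simp add: c_def min_def max_def)
  have "c e < k" if e: "e \<in> edge_set L" for e
  proof -
    obtain u w i where uw: "e = {u, w}" "((u, w), i) \<in> set L" using e by (auto simp: edge_set_def)
    obtain j where "map_of L (u, w) = Some j" using L_Some[OF uw(2)] by blast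
    then show ?thesis using c[OF L(1)[OF uw(2)]] L(3) uw(1) map_of_SomeD by fastforce
  qed
  then have range: "c ` edge_set L \<subseteq> {..<k}" by auto
  have "\<exists>F\<subseteq>edge_set L. inj_on c F \<and> (\<forall>x\<in>S. \<forall>y\<in>S. joined F x y)"
    if S: "S \<subseteq> {..<m}" "card S = 3" for S
  proof -
    obtain x y z where xyz: "S = {x, y, z}" using S(2) by (auto simp: card_3_iff)
    have "\<forall>x<m. \<forall>y<m. \<forall>z<m. \<exists>t\<in>set ts. {x, y, z} \<subseteq> set (tree_verts t)"
      using assms by (simp add: certificate_def covers_triples_def list_all_iff list_ex_iff)
    then obtain t where t: "t \<in> set ts" "x \<in> set (tree_verts t)" "y \<in> set (tree_verts t)"
      "z \<in> set (tree_verts t)"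
      using S(1) unfolding xyz by (meson insert_subset lessThan_iff)
    define F where "F = {{u, w} | u w. (u, w) \<in> set t}"
    have tL: "\<exists>i. ((u, w), i) \<in> set L" if "(u, w) \<in> set t" for u w
      using ts[OF t(1)] that map_of_SomeD unfolding rainbow_list_def list_all_iff by fastforce
    have "F \<subseteq> edge_set L" using tL by (fastforce simp: F_def edge_set_def)
    moreover have "inj_on c F"
    proof -
      have inj: "inj_on (\<lambda>e. the (map_of L e)) (set t)"
        using ts[OF t(1)] by (simp add: rainbow_list_def distinct_map)
      have "{u, w} = {u', w'}" if "(u, w) \<in> set t" "(u', w') \<in> set t" "c {u, w} = c {u', w'}"
        for u w u' w'
      proof -
        have "u < w" using tL[OF that(1)] L(1) by blast
        moreover have "u' < w'" using tL[OF that(2)] L(1) by blast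
        ultimately have "(u, w) = (u', w')" using inj_onD[OF inj _ that(1,2)] that(3) c by simp
        then show ?thesis by simp
      qed
      then show ?thesis unfolding inj_on_def F_def by (smt (verit) mem_Collect_eq)
    qed
    moreover have "joined F u v" if "u \<in> S" "v \<in> S" for u v
    proof -
      let ?r = "fst (hd t)"
      have root: "joined F ?r v" if "v \<in> set (tree_verts t)" for v
      proof (rule grows_joined)
        show "grows [?r] t" using ts[OF t(1)] by (simp add: rainbow_list_def)
        show "{u, w} \<in> F" if "(u, w) \<in> set t" for u w using that by (auto simp: F_def)
      qed (use that in auto)
      have "u \<in> set (tree_verts t)" "v \<in> set (tree_verts t)" using that t(2-4) xyz by auto
      then show ?thesis using root joined_sym joined_trans by metis
    qed
    ultimately show ?thesis by (intro exI[of _ F]) simp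
  qed
  then show ?thesis unfolding colorable_def using range by (intro exI[of _ c]) simp
qed

lemma colorable_if_certificate:
  assumes "certificate m k L ts" "finite V" "conn E V" "3 \<le> m" "branch_sets V E {..<m} B"
    and "list_all (\<lambda>((u, w), i). touch E (B u) (B w)) L"
  shows "colorable V E (k + (card V - m))"
proof -
  have "\<exists>u w. e = {u, w} \<and> u \<in> {..<m} \<and> w \<in> {..<m} \<and> u \<noteq> w \<and> touch E (B u) (B w)"
    if e: "e \<in> edge_set L" for e
  proof -
    obtain u w i where uw: "e = {u, w}" "((u, w), i) \<in> set L" using e by (auto simp: edge_set_def)
    have "u < w" "w < m" using uw assms(1) by (auto simp: certificate_def list_all_iff)
    moreover have "touch E (B u) (B w)" using uw(2) assms(6) by (auto simp: list_all_iff)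
    ultimately show ?thesis using uw(1) by (intro exI[of _ u] exI[of _ w]) auto
  qed
  then have "minor_model V E {..<m} (edge_set L) B" using assms(5) by (simp add: minor_model_def)
  from colorable_minor[OF assms(2,3) _ _ this colorable_certificate[OF assms(1)]]
  show ?thesis using assms(4) by simp
qed

text \<open>The three numbers in the name of a theta graph are the lengths of its three paths. The graphs
  with chords consist of the six-cycle \<open>0, ..., 5\<close> and two chords, \<open>{0, 2}\<close> and one of \<open>{1, 3}\<close> and
  \<open>{3, 5}\<close>. Except for the four-cycle, all colourings save \<open>3\<close>.\<close>

lemma four_cycle_certificate:
  "certificate 4 2 [((0, 1), 0), ((1, 2), 1), ((2, 3), 0), ((0, 3), 1)]
     [[(0, 1), (0, 3)], [(0, 1), (1, 2)], [(0, 3), (2, 3)], [(1, 2), (2, 3)]]"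
  by code_simp

lemma K5_certificate:
  "certificate 5 2
     [((0, 1), 0), ((1, 3), 0), ((3, 4), 0), ((2, 4), 0), ((0, 2), 0),
      ((0, 3), 1), ((2, 3), 1), ((1, 2), 1), ((1, 4), 1), ((0, 4), 1)]
     [[(0, 1), (0, 3)], [(0, 1), (0, 4)], [(0, 1), (1, 2)], [(0, 2), (0, 3)], [(0, 2), (0, 4)],
      [(0, 3), (3, 4)], [(1, 2), (1, 3)], [(1, 2), (2, 4)], [(1, 3), (1, 4)], [(2, 3), (2, 4)]]"
  by code_simp

lemma theta_133_certificate:
  "certificate 6 3
     [((0, 1), 0), ((1, 2), 1), ((2, 3), 0), ((3, 4), 2), ((4, 5), 1), ((0, 5), 2), ((0, 3), 1)]
     [[(0, 1), (0, 3), (0, 5)], [(0, 3), (2, 3), (3, 4)], [(0, 1), (0, 5), (1, 2)],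
      [(0, 1), (0, 5), (4, 5)], [(1, 2), (2, 3), (3, 4)], [(2, 3), (3, 4), (4, 5)]]"
  by code_simp

lemma theta_223_certificate:
  "certificate 6 3
     [((0, 1), 0), ((1, 2), 1), ((2, 3), 2), ((3, 4), 0), ((0, 4), 1), ((0, 5), 2), ((2, 5), 0)]
     [[(0, 1), (0, 4), (0, 5)], [(0, 1), (1, 2), (2, 3)], [(0, 4), (0, 5), (2, 5)],
      [(0, 4), (0, 5), (3, 4)], [(1, 2), (2, 3), (2, 5)], [(1, 2), (2, 3), (3, 4)]]"
  by code_simp

lemma K24_certificate:
  "certificate 6 3
     [((0, 2), 0), ((0, 3), 0), ((0, 4), 1), ((0, 5), 2),
      ((1, 2), 1), ((1, 3), 2), ((1, 4), 0), ((1, 5), 0)]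
     [[(0, 2), (0, 4), (0, 5)], [(0, 2), (1, 2), (1, 3)], [(0, 3), (0, 4), (0, 5)],
      [(0, 4), (0, 5), (1, 4)], [(1, 2), (1, 3), (1, 4)], [(1, 2), (1, 3), (1, 5)]]"
  by code_simp

lemma crossing_chords_certificate:
  "certificate 6 3
     [((0, 1), 0), ((1, 2), 0), ((2, 3), 0), ((3, 4), 2), ((4, 5), 0), ((0, 5), 2),
      ((0, 2), 1), ((1, 3), 1)]
     [[(0, 1), (0, 2), (0, 5)], [(0, 1), (1, 3), (3, 4)], [(0, 2), (0, 5), (2, 3)],
      [(0, 2), (0, 5), (4, 5)], [(1, 2), (1, 3), (3, 4)], [(1, 3), (3, 4), (4, 5)]]"
  by code_simp

lemma parallel_chords_certificate:
  "certificate 6 3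
     [((0, 1), 0), ((1, 2), 1), ((2, 3), 0), ((3, 4), 2), ((4, 5), 1), ((0, 5), 2),
      ((0, 2), 1), ((3, 5), 1)]
     [[(0, 1), (0, 2), (0, 5)], [(0, 2), (2, 3), (3, 4)], [(0, 1), (0, 5), (3, 5)],
      [(0, 1), (0, 5), (4, 5)], [(1, 2), (2, 3), (3, 4)], [(2, 3), (3, 4), (3, 5)]]"
  by code_simp

lemma theta_125_certificate:
  "certificate 7 4
     [((0, 1), 0), ((1, 2), 2), ((2, 3), 3), ((3, 4), 0), ((4, 5), 1), ((5, 6), 3), ((0, 6), 2),
      ((0, 2), 1)]
     [[(0, 1), (0, 2), (0, 6), (2, 3)], [(0, 1), (0, 6), (5, 6), (4, 5)],
      [(1, 2), (2, 3), (3, 4), (4, 5)], [(0, 2), (0, 6), (2, 3), (3, 4)],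
      [(0, 1), (0, 2), (0, 6), (5, 6)], [(0, 6), (5, 6), (4, 5), (3, 4)]]"
  by code_simp

section \<open>Cycles of branch sets\<close>

text \<open>A cycle of length \<open>k\<close> as a minor. Working with branch sets instead of vertices allows to insert
  or merge connected pieces without choosing paths in them.\<close>

definition branch_cycle :: "'a set \<Rightarrow> 'a set set \<Rightarrow> nat \<Rightarrow> (nat \<Rightarrow> 'a set) \<Rightarrow> bool" where
  "branch_cycle V E k B \<longleftrightarrow> 3 \<le> k \<and> branch_sets V E {..<k} B \<and>
     (\<forall>i<k. touch E (B i) (B (Suc i mod k)))"

lemma branch_cycleD:
  assumes "branch_cycle V E k B"
  shows "3 \<le> k" "branch_sets V E {..<k} B" "\<And>i. i < k \<Longrightarrow> touch E (B i) (B (Suc i mod k))"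
    "\<And>i. Suc i < k \<Longrightarrow> touch E (B i) (B (Suc i))" "touch E (B (k - 1)) (B 0)"
proof -
  have *: "touch E (B i) (B (Suc i mod k))" if "i < k" for i
    using that assms by (simp add: branch_cycle_def)
  then show "touch E (B i) (B (Suc i))" if "Suc i < k" for i using that *[of i] by simp
  have "0 < k" using assms by (simp add: branch_cycle_def)
  then show "touch E (B (k - 1)) (B 0)" using *[of "k - 1"] by simp
qed (use assms in \<open>auto simp: branch_cycle_def\<close>)

lemma branch_cycleI:
  assumes "3 \<le> k" "branch_sets V E {..<k} B"
    and "\<And>i. Suc i < k \<Longrightarrow> touch E (B i) (B (Suc i))" "touch E (B (k - 1)) (B 0)"
  shows "branch_cycle V E k B"
  unfolding branch_cycle_def
proof (intro conjI allI impI)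
  fix i assume "i < k"
  then consider "Suc i < k" | "i = k - 1" "Suc i = k" by linarith
  then show "touch E (B i) (B (Suc i mod k))" using assms(3,4) by cases simp_all
qed (use assms in auto)

lemma branch_cycle_touch:
  assumes "branch_cycle V E k B"
  shows "1 < k \<Longrightarrow> touch E (B 0) (B 1)" "2 < k \<Longrightarrow> touch E (B 1) (B 2)"
    "3 < k \<Longrightarrow> touch E (B 2) (B 3)" "4 < k \<Longrightarrow> touch E (B 3) (B 4)"
    "5 < k \<Longrightarrow> touch E (B 4) (B 5)" "6 < k \<Longrightarrow> touch E (B 5) (B 6)"
proof -
  have step: "touch E (B i) (B j)" if "j = Suc i" "j < k" for i j
    using branch_cycleD(4)[OF assms] that by simp
  show "1 < k \<Longrightarrow> touch E (B 0) (B 1)" "2 < k \<Longrightarrow> touch E (B 1) (B 2)"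
    "3 < k \<Longrightarrow> touch E (B 2) (B 3)" "4 < k \<Longrightarrow> touch E (B 3) (B 4)"
    "5 < k \<Longrightarrow> touch E (B 4) (B 5)" "6 < k \<Longrightarrow> touch E (B 5) (B 6)"
    by (simp_all add: step)
qed

lemma branch_cycle_close:
  assumes "branch_cycle V E k B" "Suc i = k"
  shows "touch E (B 0) (B i)"
  using touch_sym[OF branch_cycleD(5)[OF assms(1)]] assms(2) by auto

lemma branch_sets_reindex:
  assumes "branch_sets V E W B" "inj_on h W'" "h ` W' \<subseteq> W"
  shows "branch_sets V E W' (\<lambda>i. B (h i))"
  using assms unfolding branch_sets_def by (simp add: image_subset_iff inj_on_eq_iff)

lemma branch_sets_insert:
  assumes "branch_sets V E W B" "w \<notin> W" "D \<noteq> {}" "D \<subseteq> V" "conn E D"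
    and "\<And>u. u \<in> W \<Longrightarrow> B u \<inter> D = {}"
  shows "branch_sets V E (insert w W) (B(w := D))"
  using assms unfolding branch_sets_def by auto

lemma branch_sets_update:
  assumes "branch_sets V E W B" "w \<in> W" "D \<noteq> {}" "D \<subseteq> V" "conn E D"
    and "\<And>u. u \<in> W \<Longrightarrow> u \<noteq> w \<Longrightarrow> B u \<inter> D = {}"
  shows "branch_sets V E W (B(w := D))"
  using assms unfolding branch_sets_def by auto

lemma inj_on_rotation: "inj_on (\<lambda>i. (i + r) mod k) {..<k :: nat}"
proof (rule inj_onI)
  fix i j assume ij: "i \<in> {..<k}" "j \<in> {..<k}" "(i + r) mod k = (j + r) mod k"
  from ij(3) obtain q q' where "i + r + k * q = j + r + k * q'" unfolding nat_mod_eq_iff by blast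
  then have "(i + k * q) mod k = (j + k * q') mod k" by simp
  then show "i = j" using ij(1,2) by simp
qed

lemma branch_cycle_rotate:
  assumes "branch_cycle V E k B"
  shows "branch_cycle V E k (\<lambda>i. B ((i + r) mod k))"
  unfolding branch_cycle_def
proof (intro conjI allI impI)
  note B = branch_cycleD[OF assms]
  show "3 \<le> k" by (rule B)
  show "branch_sets V E {..<k} (\<lambda>i. B ((i + r) mod k))"
    using B(1) by (intro branch_sets_reindex[OF B(2) inj_on_rotation]) auto
  fix i assume "i < k"
  have "(i + r) mod k < k" using \<open>i < k\<close> by simp
  from B(3)[OF this] show "touch E (B ((i + r) mod k)) (B ((Suc i mod k + r) mod k))"
    by (simp add: mod_Suc_eq mod_add_left_eq)
qed

lemma branch_cycle_add_last:
  assumes "branch_cycle V E k B" "D \<noteq> {}" "D \<subseteq> V" "conn E D" "\<And>i. i < k \<Longrightarrow> B i \<inter> D = {}"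
    and "touch E (B (k - 1)) D" "touch E D (B 0)"
  shows "branch_cycle V E (Suc k) (B(k := D))"
proof (rule branch_cycleI)
  note B = branch_cycleD[OF assms(1)]
  show "3 \<le> Suc k" using B(1) by simp
  have "branch_sets V E (insert k {..<k}) (B(k := D))"
    using assms(2-5) by (intro branch_sets_insert[OF B(2)]) auto
  then show "branch_sets V E {..<Suc k} (B(k := D))" by (simp add: lessThan_Suc)
  show "touch E ((B(k := D)) (Suc k - 1)) ((B(k := D)) 0)" using assms(7) B(1) by simp
  fix i assume i: "Suc i < Suc k"
  show "touch E ((B(k := D)) i) ((B(k := D)) (Suc i))"
  proof (cases "Suc i = k")
    case True
    then have "i = k - 1" "i \<noteq> k" by auto
    then show ?thesis using assms(6) True by simp
  qed (use i B(4)[of i] in simp)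
qed

text \<open>If the neighbouring branch sets can be reached from two different vertices \<open>x\<close> and \<open>y\<close> of a branch
  set, it splits into two consecutive ones.\<close>

lemma branch_cycle_split:
  assumes "branch_cycle V E k B" "p \<in> B (k - 2)" "{p, x} \<in> E" "x \<in> B (k - 1)" "y \<in> B (k - 1)"
    and "{y, q} \<in> E" "q \<in> B 0" "x \<noteq> y"
  shows "\<exists>B'. branch_cycle V E (Suc k) B'"
proof -
  note B = branch_cycleD[OF assms(1)]
  define l where "l = k - 1"
  have k: "k = Suc l" "2 \<le> l" using B(1) by (auto simp: l_def)
  have l: "branch_sets V E {..<k} B" "l \<in> {..<k}" using B(2) k by auto
  note Bl = branch_setsD[OF l]
  obtain P Q where PQ: "P \<subseteq> B l" "Q \<subseteq> B l" "P \<inter> Q = {}" "conn E P" "conn E Q"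
    "x \<in> P" "y \<in> Q" "touch E P Q"
    using conn_split[OF Bl(3), of x y] assms(4,5,8) by (auto simp: l_def)
  have disj: "B i \<inter> B l = {}" if "i < k" "i \<noteq> l" for i
    using l(1) that k(1) unfolding branch_sets_def by blast
  let ?B = "B(l := P)"
  have "branch_sets V E {..<k} ?B"
    using PQ Bl(2) disj by (intro branch_sets_update[OF l]) blast+
  then have "branch_sets V E (insert k {..<k}) (?B(k := Q))"
  proof (rule branch_sets_insert)
    fix i assume "i \<in> {..<k}"
    then show "?B i \<inter> Q = {}" using PQ disj[of i] by auto
  qed (use PQ Bl(2) in auto)
  then have "branch_sets V E {..<Suc k} (?B(k := Q))" by (simp add: lessThan_Suc)
  moreover have "touch E ((?B(k := Q)) i) ((?B(k := Q)) (Suc i))" if i: "Suc i < Suc k" for i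
  proof -
    consider "Suc i < l" | "Suc i = l" | "i = l" using i k by linarith
    then show ?thesis
    proof cases
      case 1
      then show ?thesis using B(4)[of i] k by simp
    next
      case 2
      then have "i = k - 2" using k by simp
      then have "p \<in> B i" using assms(2) by simp
      then show ?thesis using 2 assms(3) PQ(6) k by (auto simp: touch_def)
    next
      case 3
      then show ?thesis using PQ(8) k by simp
    qed
  qed
  moreover have "touch E ((?B(k := Q)) (Suc k - 1)) ((?B(k := Q)) 0)"
    using assms(6,7) PQ(7) k by (auto simp: touch_def)
  ultimately have "branch_cycle V E (Suc k) (?B(k := Q))" using B(1) by (intro branch_cycleI) auto
  then show ?thesis by (intro exI[of _ "?B(k := Q)"])
qed

text \<open>When the cycle cannot be lengthened, an edge enters each branch set at the vertex where the next
  edge leaves it, as the set could otherwise be split. These vertices form a cycle, so a longest cycle minor is realised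
  by a cycle.\<close>

lemma maximal_branch_cycle_vertices:
  assumes "branch_cycle V E k B" "\<nexists>B'. branch_cycle V E (Suc k) B'"
  shows "\<exists>v. branch_cycle V E k (\<lambda>i. {v i})"
proof -
  note B = branch_cycleD[OF assms(1)]
  have "\<forall>i\<in>{..<k}. \<exists>e. fst e \<in> B i \<and> snd e \<in> B (Suc i mod k) \<and> {fst e, snd e} \<in> E"
    using B(3) by (fastforce simp: touch_def)
  from bchoice[OF this] obtain g where g: "\<And>i. i < k \<Longrightarrow> fst (g i) \<in> B i"
    "\<And>i. i < k \<Longrightarrow> snd (g i) \<in> B (Suc i mod k)" "\<And>i. i < k \<Longrightarrow> {fst (g i), snd (g i)} \<in> E"
    by auto
  define v where "v i = fst (g i)" for i
  have snd_g: "snd (g j) = v (Suc j mod k)" if j: "j < k" for j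
  proof (rule ccontr)
    assume neq: "snd (g j) \<noteq> v (Suc j mod k)"
    let ?j = "Suc j mod k"
    let ?B = "\<lambda>i. B ((i + (j + 2)) mod k)"
    have idx: "?B (k - 2) = B j" "?B (k - 1) = B ?j" "?B 0 = B (Suc ?j mod k)"
    proof -
      have *: "k - 2 + (j + 2) = j + k" "k - 1 + (j + 2) = Suc j + k" using B(1) by auto
      show "?B (k - 2) = B j" "?B (k - 1) = B ?j" using j by (simp_all only: * mod_add_self2) simp
      show "?B 0 = B (Suc ?j mod k)" by (simp add: mod_Suc_eq)
    qed
    have j': "?j < k" using j by simp
    have "\<exists>B'. branch_cycle V E (Suc k) B'"
      using g(1)[OF j] g(3)[OF j] g(2)[OF j] g(1)[OF j'] g(3)[OF j'] g(2)[OF j'] neq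
      by (intro branch_cycle_split[OF branch_cycle_rotate[OF assms(1), of "j + 2"],
            of "fst (g j)" "snd (g j)" "v ?j" "snd (g ?j)"]) (simp_all only: idx v_def not_False_eq_True)
    then show False using assms(2) by blast
  qed
  have v: "v i \<in> B i" if "i < k" for i using g(1)[OF that] by (simp add: v_def)
  have "v i \<in> V" if "i < k" for i using v[OF that] branch_setsD(2)[OF B(2), of i] that by auto
  moreover have "v i \<noteq> v j" if "i < k" "j < k" "i \<noteq> j" for i j
    using branch_sets_eq[OF B(2), of i j "v i"] v[OF that(1)] v[OF that(2)] that by auto
  ultimately have "branch_sets V E {..<k} (\<lambda>i. {v i})" by (simp add: branch_sets_def)
  moreover have "touch E {v i} {v (Suc i mod k)}" if "i < k" for i
    using g(3)[OF that] snd_g[OF that] by (simp add: touch_def v_def)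
  ultimately show ?thesis using B(1) by (intro exI[of _ v]) (simp add: branch_cycle_def)
qed

text \<open>Contraction of the arc \<open>m, ..., k - 1\<close> to a single branch set.\<close>

definition merge_from :: "(nat \<Rightarrow> 'a set) \<Rightarrow> nat \<Rightarrow> nat \<Rightarrow> nat \<Rightarrow> 'a set" where
  "merge_from B m k i = (if i = m then \<Union>j\<in>{m..<k}. B j else B i)"

lemma conn_interval:
  assumes "\<And>i. i < k \<Longrightarrow> conn E (B i)" "\<And>i. Suc i < k \<Longrightarrow> touch E (B i) (B (Suc i))" "m < k"
  shows "conn E (\<Union>j\<in>{m..<k}. B j)"
  using assms(3,1,2)
proof (induction k)
  case (Suc k)
  show ?case
  proof (cases "m = k")
    case False
    then have "m < k" using Suc.prems(1) by simp
    have "conn E ((\<Union>j\<in>{m..<k}. B j) \<union> B k)"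
    proof (rule conn_Un)
      show "conn E (\<Union>j\<in>{m..<k}. B j)" using Suc.IH \<open>m < k\<close> Suc.prems by simp
      show "conn E (B k)" using Suc.prems by simp
      have "touch E (B (k - 1)) (B k)" using Suc.prems(3)[of "k - 1"] \<open>m < k\<close> by simp
      then show "touch E (\<Union>j\<in>{m..<k}. B j) (B k)"
        by (rule touch_mono) (use \<open>m < k\<close> in \<open>auto intro!: bexI[of _ "k - 1"]\<close>)
    qed
    moreover have "{m..<Suc k} = insert k {m..<k}" using \<open>m < k\<close> by auto
    ultimately show ?thesis by (simp add: Un_commute)
  qed (use Suc.prems in simp)
qed simp

lemma branch_cycle_merge:
  assumes "branch_cycle V E k B" "2 \<le> m" "m < k" "l = Suc m"
  shows "branch_cycle V E l (merge_from B m k)"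
  unfolding assms(4)
proof (rule branch_cycleI)
  note B = branch_cycleD[OF assms(1)]
  have Bi: "B i \<noteq> {}" "B i \<subseteq> V" "conn E (B i)" if "i < k" for i
    using branch_setsD[OF B(2)] that by auto
  have disj: "B i \<inter> B j = {}" if "i < k" "j < k" "i \<noteq> j" for i j
    using B(2) that unfolding branch_sets_def by simp
  let ?U = "\<Union>j\<in>{m..<k}. B j"
  have "conn E ?U" using Bi(3) B(4) assms(3) by (rule conn_interval)
  moreover have "?U \<noteq> {}" "?U \<subseteq> V" using assms(3) Bi by force+
  ultimately have "branch_sets V E (insert m {..<m}) (B(m := ?U))"
  proof (intro branch_sets_insert)
    show "branch_sets V E {..<m} B" using B(2) assms(3) by (auto simp: branch_sets_def)
    show "B i \<inter> ?U = {}" if "i \<in> {..<m}" for i using disj[of i] that assms(3) by fastforce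
  qed auto
  moreover have "B(m := ?U) = merge_from B m k" by (auto simp: merge_from_def)
  ultimately show "branch_sets V E {..<Suc m} (merge_from B m k)" by (simp add: lessThan_Suc)
  show "3 \<le> Suc m" using assms(2) by simp
  show "touch E (merge_from B m k i) (merge_from B m k (Suc i))" if "Suc i < Suc m" for i
    by (rule touch_mono[OF B(4)[of i]]) (use that assms in \<open>auto simp: merge_from_def\<close>)
  show "touch E (merge_from B m k (Suc m - 1)) (merge_from B m k 0)"
    by (rule touch_mono[OF B(5)])
      (use assms in \<open>auto simp: merge_from_def intro!: bexI[of _ "k - 1"]\<close>)
qed

section \<open>Longest cycles in 2-connected graphs\<close>

locale two_connected =
  fixes V :: "'a set" and E :: "'a set set"
  assumes finite_V: "finite V"
    and order: "3 \<le> card V"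
    and conn_V: "conn E V"
    and conn_remove: "x \<in> V \<Longrightarrow> conn E (V - {x})"
    and edge: "e \<in> E \<Longrightarrow> \<exists>x y. e = {x, y} \<and> x \<noteq> y \<and> x \<in> V \<and> y \<in> V"
begin

text \<open>A vertex \<open>a\<close> has two neighbours, since no single vertex separates it from the rest. The graph
  without \<open>a\<close> is connected and splits into a part for each of the two.\<close>

lemma branch_cycle_exists: "\<exists>B. branch_cycle V E 3 B"
proof -
  obtain S where S: "S \<subseteq> V" "card S = 3" by (rule obtain_subset_with_card_n[OF order])
  then obtain a b c where abc: "a \<in> V" "b \<in> V" "c \<in> V" "a \<noteq> b" "b \<noteq> c" "a \<noteq> c"
    by (auto simp: card_3_iff)
  have "b \<notin> {a}" using abc by simp
  from conn_crosses[OF conn_V abc(1) singletonI abc(2) this]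
  obtain u where u: "u \<in> V" "u \<noteq> a" "{a, u} \<in> E" by auto
  have au: "a \<in> V - {u}" using abc(1) u(2) by simp
  obtain z where z: "z \<in> V - {u}" "z \<notin> {a}" using abc by (cases "b = u") auto
  from conn_crosses[OF conn_remove[OF u(1)] au singletonI z]
  obtain w where w: "w \<in> V" "w \<noteq> a" "w \<noteq> u" "{a, w} \<in> E" by auto
  obtain P Q where PQ: "P \<subseteq> V - {a}" "Q \<subseteq> V - {a}" "P \<inter> Q = {}" "conn E P" "conn E Q"
    "u \<in> P" "w \<in> Q" "touch E P Q"
    using conn_split[OF conn_remove[OF abc(1)], of u w] u w by auto
  let ?B = "(\<lambda>i :: nat. {a})(1 := P, 2 := Q)"
  have three: "{..<3} = {0, 1, 2 :: nat}" by auto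
  have "branch_cycle V E 3 ?B"
  proof (rule branch_cycleI)
    show "branch_sets V E {..<3} ?B"
      unfolding branch_sets_def three using PQ abc(1) by auto
    show "touch E (?B (3 - 1)) (?B 0)" using w(4) PQ(7) by (auto simp: touch_def insert_commute)
    fix i :: nat assume "Suc i < 3"
    then consider "i = 0" | "i = 1" by linarith
    then show "touch E (?B i) (?B (Suc i))"
      using u(3) PQ(6,8) by cases (auto simp: touch_def numeral_2_eq_2)
  qed simp
  then show ?thesis by (intro exI[of _ ?B])
qed

lemma branch_sets_card:
  assumes "branch_sets V E {..<k} B"
  shows "k \<le> card V"
proof -
  have "\<forall>i\<in>{..<k}. \<exists>x. x \<in> B i" using branch_setsD(1)[OF assms] by blast
  from bchoice[OF this] obtain f where f: "\<forall>i\<in>{..<k}. f i \<in> B i" ..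
  have "inj_on f {..<k}" using branch_sets_eq[OF assms] f by (metis inj_onI)
  moreover have "f ` {..<k} \<subseteq> V" using f branch_setsD(2)[OF assms] by blast
  ultimately show ?thesis using card_inj_on_le[OF _ _ finite_V] by fastforce
qed

text \<open>The cycle is required to be maximal among the cycle minors; this is the stronger form needed
  to exclude extensions through connected pieces.\<close>

lemma longest_cycle_exists:
  "\<exists>k v. branch_cycle V E k (\<lambda>i. {v i}) \<and> (\<nexists>B. branch_cycle V E (Suc k) B)"
proof -
  define P where "P k \<longleftrightarrow> (\<exists>B. branch_cycle V E k B)" for k
  have bound: "k \<le> card V" if "P k" for k
    using that branch_sets_card branch_cycleD(2) unfolding P_def by metis
  define k where "k = Greatest P"
  have "P 3" using branch_cycle_exists by (simp add: P_def)
  then have "P k" unfolding k_def using bound by (rule GreatestI_nat)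
  have "\<not> P (Suc k)"
  proof
    assume "P (Suc k)"
    then have "Suc k \<le> Greatest P" using bound by (rule Greatest_le_nat)
    then show False by (simp add: k_def)
  qed
  then have nlong: "\<nexists>B. branch_cycle V E (Suc k) B" by (simp add: P_def)
  from \<open>P k\<close> obtain B where "branch_cycle V E k B" unfolding P_def ..
  from maximal_branch_cycle_vertices[OF this nlong] show ?thesis using nlong by blast
qed

lemma colorable_minus_3_if_certificate:
  assumes "certificate m k L ts" "3 \<le> m" "m = k + 3" "branch_sets V E {..<m} B"
    and "list_all (\<lambda>((u, w), i). touch E (B u) (B w)) L"
  shows "colorable V E (card V - 3)"
proof -
  have "k + (card V - m) = card V - 3" using branch_sets_card[OF assms(4)] assms(3) by simp
  then show ?thesis
    using colorable_if_certificate[OF assms(1) finite_V conn_V assms(2,4,5)] by simp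
qed

text \<open>Both arcs between the ends of the chord have length at least \<open>3\<close>. The first merge shortens the
  arc from \<open>l\<close> back to \<open>0\<close> to length \<open>3\<close>; after a rotation that puts \<open>l\<close> first, the second one shortens the other
  arc.\<close>

lemma colorable_long_chord:
  assumes "branch_cycle V E k B" "touch E (B 0) (B l)" "3 \<le> l" "l + 3 \<le> k"
  shows "colorable V E (card V - 3)"
proof -
  let ?B1 = "merge_from B (l + 2) k"
  have B1: "branch_cycle V E (l + 3) ?B1"
    using assms(3,4) by (intro branch_cycle_merge[OF assms(1)]) simp_all
  let ?B2 = "\<lambda>i. ?B1 ((i + l) mod (l + 3))"
  let ?B = "merge_from ?B2 5 (l + 3)"
  have B: "branch_cycle V E 6 ?B"
    using assms(3) by (intro branch_cycle_merge[OF branch_cycle_rotate[OF B1]]) simp_all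
  have "?B 0 = B l" by (simp add: merge_from_def)
  moreover have "?B 3 = B 0" by (simp add: merge_from_def add.commute)
  ultimately have "touch E (?B 0) (?B 3)" using assms(2) touch_sym by simp
  then show ?thesis
    using branch_cycleD(2)[OF B] branch_cycle_touch[OF B] branch_cycle_close[OF B]
    by (intro colorable_minus_3_if_certificate[OF theta_133_certificate, of ?B]) simp_all
qed

text \<open>Here the theta graph with path lengths \<open>1,2,4\<close>, which is the case \<open>k = 6\<close>, would not be enough: it is
  contained in the 3-sun.\<close>

lemma colorable_short_chord:
  assumes "branch_cycle V E k B" "touch E (B 0) (B 2)" "7 \<le> k"
  shows "colorable V E (card V - 3)"
proof -
  let ?B = "merge_from B 6 k"
  have B: "branch_cycle V E 7 ?B"
    using assms(3) by (intro branch_cycle_merge[OF assms(1)]) simp_all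
  have "touch E (?B 0) (?B 2)" using assms(2) by (simp add: merge_from_def)
  then show ?thesis
    using branch_cycleD(2)[OF B] branch_cycle_touch[OF B] branch_cycle_close[OF B]
    by (intro colorable_minus_3_if_certificate[OF theta_125_certificate, of ?B]) simp_all
qed

text \<open>The arc from \<open>2\<close> back to \<open>0\<close> shrinks to length \<open>3\<close>; the other two paths go through \<open>1\<close> and \<open>D\<close>.\<close>

lemma colorable_detour:
  assumes "branch_cycle V E k B" "5 \<le> k" "D \<noteq> {}" "D \<subseteq> V" "conn E D"
    and "\<And>i. i < k \<Longrightarrow> B i \<inter> D = {}" "touch E (B 0) D" "touch E (B 2) D"
  shows "colorable V E (card V - 3)"
proof -
  let ?B1 = "merge_from B 4 k"
  have B1: "branch_cycle V E 5 ?B1"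
    using assms(2) by (intro branch_cycle_merge[OF assms(1)]) simp_all
  let ?B = "?B1(5 := D)"
  have "branch_sets V E (insert 5 {..<5}) ?B"
  proof (intro branch_sets_insert branch_cycleD(2)[OF B1] assms(3-5))
    show "?B1 i \<inter> D = {}" if "i \<in> {..<5}" for i
    proof -
      have "x \<notin> B j" if "j < k" "x \<in> D" for j x using assms(6)[OF that(1)] that(2) by blast
      then show ?thesis using that assms(2) by (auto simp: merge_from_def)
    qed
  qed simp
  moreover have "insert 5 {..<5} = {..<6 :: nat}" by auto
  ultimately have "branch_sets V E {..<6} ?B" by simp
  moreover have "touch E (?B 0) (?B 5)" "touch E (?B 2) (?B 5)"
    using assms(7,8) by (simp_all add: merge_from_def)
  ultimately show ?thesis
    using branch_cycle_touch[OF B1] branch_cycle_close[OF B1]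
    by (intro colorable_minus_3_if_certificate[OF theta_223_certificate, of ?B]) simp_all
qed

lemma colorable_K24:
  assumes "branch_cycle V E 4 (\<lambda>i. {v i})" "d \<in> V - v ` {..<4}" "d' \<in> V - v ` {..<4}" "d \<noteq> d'"
    and "{d, v 0} \<in> E" "{d, v 2} \<in> E" "{d', v 0} \<in> E" "{d', v 2} \<in> E"
  shows "colorable V E (card V - 3)"
proof -
  note B = branch_cycleD[OF assms(1)]
  have cycle: "{v 0, v 1} \<in> E" "{v 1, v 2} \<in> E" "{v 2, v 3} \<in> E" "{v 0, v 3} \<in> E"
    using branch_cycle_touch(1-3)[OF assms(1)] branch_cycle_close[OF assms(1), of 3]
    by (simp_all add: touch_def)
  let ?x = "(!) [v 0, v 2, v 1, v 3, d, d']"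
  have four: "{..<4} = {0, 1, 2, 3 :: nat}" and six: "{..<6} = {0, 1, 2, 3, 4, 5 :: nat}" by auto
  have "branch_sets V E {..<6} (\<lambda>i. {?x i})"
    using B(2) assms(2-4) unfolding branch_sets_def four six
    by auto
  then show ?thesis
    using cycle assms(5-8)
    by (intro colorable_minus_3_if_certificate[OF K24_certificate, of "\<lambda>i. {?x i}"])
      (simp_all add: touch_def insert_commute)
qed

end

context two_connected
begin

text \<open>One attachment exists by connectivity; if it were the only one, its deletion would disconnect
  the graph.\<close>

lemma component_attaches_twice:
  assumes cyc: "branch_cycle V E k (\<lambda>i. {v i})" and d: "d \<in> V - v ` {..<k}"
    and D: "D = component E (V - v ` {..<k}) d"
  shows "\<exists>i<k. \<exists>j<k. i \<noteq> j \<and> touch E D {v i} \<and> touch E D {v j}"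
proof -
  let ?C = "v ` {..<k}"
  note B = branch_cycleD[OF cyc]
  have vV: "v i \<in> V" if "i < k" for i using branch_setsD(2)[OF B(2)] that by auto
  have inj: "v i \<noteq> v j" if "i < k" "j < k" "i \<noteq> j" for i j
    using branch_sets_eq[OF B(2)] that by auto
  have sub: "D \<subseteq> V - ?C" using component_subset[OF d] D by simp
  have k: "0 < k" "1 < k" using B(1) by auto
  have "D \<subseteq> V" "v 0 \<in> V" "v 0 \<notin> D" using sub vV k by auto
  then obtain b where "b \<in> ?C" "touch E D {b}"
    using component_leaves[OF conn_V D d _ subset_refl] by blast
  then obtain i where i: "i < k" "touch E D {v i}" by auto
  obtain j where j: "j < k" "j \<noteq> i" using k by (metis zero_neq_one)
  have "v j \<in> V - {v i}" "v j \<notin> D" using vV inj[OF j(1) i(1) j(2)] j sub by auto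
  moreover have "D \<subseteq> V - {v i}" using sub i(1) by auto
  ultimately obtain b where "b \<in> ?C" "b \<noteq> v i" "touch E D {b}"
    using component_leaves[OF conn_remove[OF vV[OF i(1)]] D d _ Diff_subset] by blast
  then show ?thesis using i by blast
qed

text \<open>Any two positions on a cycle can be rotated to \<open>0\<close> and \<open>l\<close>, where the arc from \<open>0\<close> to \<open>l\<close> is the
  shorter one. This removes reflections from all case distinctions.\<close>

lemma rotation_arc:
  fixes i j k :: nat
  assumes "i < k" "j < k" "i \<noteq> j"
  shows "\<exists>r l. 0 < l \<and> 2 * l \<le> k \<and>
    (r mod k = i \<and> (l + r) mod k = j \<or> r mod k = j \<and> (l + r) mod k = i)"
proof -
  have *: "\<exists>r l. 0 < l \<and> 2 * l \<le> k \<and>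
      (r mod k = i \<and> (l + r) mod k = j \<or> r mod k = j \<and> (l + r) mod k = i)"
    if "i < j" "j < k" for i j
  proof (cases "2 * (j - i) \<le> k")
    case True
    then show ?thesis using that by (intro exI[of _ i] exI[of _ "j - i"]) auto
  next
    case False
    have "k - (j - i) + j = i + k" using that by simp
    then have "(k - (j - i) + j) mod k = i" using that by simp
    then show ?thesis using False that by (intro exI[of _ j] exI[of _ "k - (j - i)"]) auto
  qed
  show ?thesis
  proof (cases "i < j")
    case False
    then have "j < i" using assms(3) by simp
    from *[OF this assms(1)] show ?thesis by blast
  qed (use * assms(2) in blast)
qed

lemma rotation_image: "(\<lambda>i. v ((i + r) mod k)) ` {..<k :: nat} = v ` {..<k}"
proof (cases "k = 0")
  case False
  have "(\<lambda>i. (i + r) mod k) ` {..<k} \<subseteq> {..<k}" using False by auto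
  then have "(\<lambda>i. (i + r) mod k) ` {..<k} = {..<k}"
    using endo_inj_surj[OF finite_lessThan _ inj_on_rotation] by blast
  then show ?thesis by (metis image_image)
qed simp

end

locale longest_cycle = two_connected V E for V :: "'a set" and E :: "'a set set" +
  fixes k :: nat and v :: "nat \<Rightarrow> 'a"
  assumes cycle: "branch_cycle V E k (\<lambda>i. {v i})"
    and no_longer: "\<nexists>B. branch_cycle V E (Suc k) B"
begin

lemma cycle_vertex: "i < k \<Longrightarrow> v i \<in> V"
  using branch_setsD(2)[OF branch_cycleD(2)[OF cycle], of i] by simp

lemma cycle_inj: "i < k \<Longrightarrow> j < k \<Longrightarrow> v i = v j \<Longrightarrow> i = j"
  using branch_sets_eq[OF branch_cycleD(2)[OF cycle], of i j "v i"] by simp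

lemma longest_cycle_rotate: "longest_cycle V E k (\<lambda>i. v ((i + r) mod k))"
  using branch_cycle_rotate[OF cycle, of r] no_longer
  by unfold_locales

text \<open>Otherwise \<open>D\<close> could be inserted between the two.\<close>

lemma no_adjacent_attachments:
  assumes "D \<noteq> {}" "D \<subseteq> V - v ` {..<k}" "conn E D" "touch E D {v 0}"
  shows "\<not> touch E D {v 1}"
proof
  assume "touch E D {v 1}"
  note B = branch_cycleD[OF cycle]
  let ?B = "\<lambda>i. {v ((i + 1) mod k)}"
  have "?B (k - 1) = {v 0}" "?B 0 = {v 1}" using B(1) by auto
  then have "branch_cycle V E (Suc k) (?B(k := D))"
    using assms \<open>touch E D {v 1}\<close> touch_sym[OF assms(4)] B(1)
    by (intro branch_cycle_add_last[OF branch_cycle_rotate[OF cycle, of 1]]) auto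
  then show False using no_longer by blast
qed

text \<open>By maximality the attachments are at distance \<open>l \<ge> 2\<close> along the cycle.\<close>

lemma detour:
  assumes "d \<in> V - v ` {..<k}"
  defines "D \<equiv> component E (V - v ` {..<k}) d"
  shows "\<exists>r l. 2 \<le> l \<and> 2 * l \<le> k \<and> touch E D {v (r mod k)} \<and> touch E D {v ((l + r) mod k)}"
proof -
  obtain i j where ij: "i < k" "j < k" "i \<noteq> j" "touch E D {v i}" "touch E D {v j}"
    using component_attaches_twice[OF cycle assms(1)] D_def by blast
  obtain r l where l: "0 < l" "2 * l \<le> k"
    and rl: "r mod k = i \<and> (l + r) mod k = j \<or> r mod k = j \<and> (l + r) mod k = i"
    using rotation_arc[OF ij(1-3)] by blast
  have touch: "touch E D {v (r mod k)}" "touch E D {v ((l + r) mod k)}" using rl ij(4,5) by auto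
  interpret r: longest_cycle V E k "\<lambda>i. v ((i + r) mod k)" by (rule longest_cycle_rotate)
  have "D \<noteq> {}" "D \<subseteq> V - v ` {..<k}" "conn E D"
    using component_subset[OF assms(1)] conn_component[OF assms(1)] by (auto simp: D_def)
  then have "\<not> touch E D {v ((1 + r) mod k)}"
    using r.no_adjacent_attachments[of D] touch(1) by (simp add: rotation_image)
  then have "l \<noteq> 1" using touch(2) by auto
  then show ?thesis using l touch by (intro exI[of _ r] exI[of _ l]) auto
qed

lemma length_ge_4:
  assumes "4 \<le> card V"
  shows "4 \<le> k"
proof (cases "V \<subseteq> v ` {..<k}")
  case True
  have "card V \<le> card (v ` {..<k})" by (rule card_mono[OF _ True]) simp
  also have "\<dots> \<le> k" using card_image_le[of "{..<k}" v] by simp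
  finally show ?thesis using assms by simp
next
  case False
  then obtain d where "d \<in> V - v ` {..<k}" by blast
  from detour[OF this] show ?thesis by auto
qed

lemma colorable_minus_2:
  assumes "4 \<le> card V"
  shows "colorable V E (card V - 2)"
proof -
  let ?B = "merge_from (\<lambda>i. {v i}) 3 k"
  have B: "branch_cycle V E 4 ?B"
    using length_ge_4[OF assms] by (intro branch_cycle_merge[OF cycle]) simp_all
  have "colorable V E (2 + (card V - 4))"
    using branch_cycle_touch[OF B] branch_cycle_close[OF B] branch_cycleD(2)[OF B]
    by (intro colorable_if_certificate[OF four_cycle_certificate finite_V conn_V, of ?B]) simp_all
  moreover have "2 + (card V - 4) = card V - 2" using assms by simp
  ultimately show ?thesis by simp
qed

text \<open>Let \<open>D\<close> be the component of \<open>d\<close>. Edges from different vertices of \<open>D\<close> to \<open>v 0\<close> and \<open>v 2\<close> would give a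
  longer cycle, so all these edges come from one vertex \<open>x\<close>. Further vertices of \<open>D\<close> would be cut off by \<open>x\<close>,
  because \<open>v 1\<close> and \<open>v 3\<close>, being next to the attachment \<open>v 0\<close>, are not attachments themselves. Thus \<open>D = {d}\<close>.\<close>

lemma four_cycle_attachment:
  assumes k: "k = 4" and d: "d \<in> V - v ` {..<k}"
    and touch: "touch E (component E (V - v ` {..<k}) d) {v 0}"
      "touch E (component E (V - v ` {..<k}) d) {v 2}"
  shows "{d, v 0} \<in> E \<and> {d, v 2} \<in> E"
proof -
  define D where "D = component E (V - v ` {..<k}) d"
  have D: "D \<noteq> {}" "D \<subseteq> V - v ` {..<k}" "conn E D" "d \<in> D"
    using component_subset[OF d] conn_component[OF d] by (auto simp: D_def)
  note B = branch_cycleD[OF cycle]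
  have same: "x = y" if x: "x \<in> D" "{x, v 2} \<in> E" and y: "y \<in> D" "{y, v 0} \<in> E" for x y
  proof (rule ccontr)
    assume "x \<noteq> y"
    \<comment> \<open>\<open>D\<close> replaces \<open>v 3\<close> and can then be split.\<close>
    let ?B = "(\<lambda>i. {v i})(3 := D)"
    have "branch_sets V E {..<4} ?B"
      using B(2) D k by (intro branch_sets_update) auto
    moreover have "touch E (?B i) (?B (Suc i))" if "Suc i < 4" for i
    proof -
      have "i = 2" if "3 = Suc i" using that by simp
      then show ?thesis
        using B(4)[of i] that k x by (auto simp: touch_def insert_commute)
    qed
    moreover have "touch E (?B (4 - 1)) (?B 0)" using y by (auto simp: touch_def)
    ultimately have cyc: "branch_cycle V E k ?B" unfolding k by (intro branch_cycleI) auto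
    have "\<exists>B'. branch_cycle V E (Suc k) B'"
      using x y \<open>x \<noteq> y\<close> k
      by (intro branch_cycle_split[OF cyc, of "v 2" x y "v 0"]) (auto simp: insert_commute)
    then show False using no_longer by blast
  qed
  obtain x where x: "x \<in> D" "{x, v 2} \<in> E" using touch(2) by (auto simp: touch_def D_def)
  obtain y where y: "y \<in> D" "{y, v 0} \<in> E" using touch(1) by (auto simp: touch_def D_def)
  have xy: "y = x" using same[OF x y] by simp
  have "D \<subseteq> {x}"
  proof (rule ccontr)
    assume "\<not> D \<subseteq> {x}"
    then obtain z where z: "z \<in> D" "z \<noteq> x" by blast
    have xV: "x \<in> V" and zV: "z \<in> V - {x}" "z \<in> D - {x}" using x(1) z D(2) by auto
    have v0: "v 0 \<in> V - {x}" "v 0 \<notin> D - {x}" using cycle_vertex[of 0] D(2) x(1) k by auto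
    from conn_crosses[OF conn_remove[OF xV] zV v0]
    obtain a b where ab: "a \<in> D" "a \<noteq> x" "b \<in> V" "b \<notin> D" "{a, b} \<in> E" by blast
    have "b \<in> v ` {..<k}"
      using component_closed[OF d, of a E b] ab unfolding D_def[symmetric] by blast
    then obtain i where i: "b = v i" "i < k" by blast
    then have touch_i: "touch E D {v i}" using ab by (auto simp: touch_def)
    have touch': "touch E D {v 0}" using touch(1) by (simp add: D_def)
    interpret r: longest_cycle V E k "\<lambda>j. v ((j + 3) mod k)" by (rule longest_cycle_rotate)
    have "i \<noteq> 1" using no_adjacent_attachments[OF D(1-3) touch'] touch_i by auto
    moreover have "i \<noteq> 3"
      using r.no_adjacent_attachments[OF D(1) _ D(3)] touch' touch_i D(2) k
      by (auto simp: rotation_image)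
    moreover have "i \<noteq> 0"
    proof
      assume "i = 0"
      then have "x = a" using same[OF x ab(1)] ab(5) i(1) by simp
      then show False using ab(2) by simp
    qed
    moreover have "i \<noteq> 2"
    proof
      assume "i = 2"
      then have "a = y" using same[OF ab(1) _ y] ab(5) i(1) by simp
      then show False using ab(2) xy by simp
    qed
    ultimately show False using i(2) k by linarith
  qed
  then show ?thesis using x y xy D(4) by auto
qed

text \<open>A component outside the cycle attaches at distance \<open>l\<close> with \<open>2 \<le> l\<close> and \<open>2 * l \<le> k\<close>. For \<open>l \<ge> 3\<close> it is
  merged into one end, which makes it a long chord; for \<open>l = 2\<close> and \<open>k \<ge> 5\<close> it is a detour. For \<open>k = 4\<close> there are
  at least two outside vertices, each joined to a pair of opposite cycle vertices. The same pair gives \<open>K\<^sub>2\<^sub>,\<^sub>4\<close>;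
  different pairs give a cycle of length \<open>6\<close>.\<close>

lemma colorable_if_not_Hamiltonian:
  assumes "\<not> V \<subseteq> v ` {..<k}" "6 \<le> card V"
  shows "colorable V E (card V - 3)"
proof -
  note B = branch_cycleD[OF cycle]
  have rot: "longest_cycle V E k (\<lambda>i. v ((i + r) mod k))" for r by (rule longest_cycle_rotate)
  obtain d where d: "d \<in> V - v ` {..<k}" using assms(1) by blast
  have "4 \<le> k" using length_ge_4 assms(2) by simp
  show ?thesis
  proof (cases "k = 4")
    case True
    have opposite: "{x, v 0} \<in> E \<and> {x, v 2} \<in> E \<or> {x, v 1} \<in> E \<and> {x, v 3} \<in> E"
      if x: "x \<in> V - v ` {..<k}" for x
    proof -
      let ?D = "component E (V - v ` {..<k}) x"
      obtain r l where rl: "2 \<le> l" "2 * l \<le> k" "touch E ?D {v (r mod k)}"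
        "touch E ?D {v ((l + r) mod k)}"
        using detour[OF x] by blast
      then have l: "l = 2" using True by simp
      interpret r: longest_cycle V E k "\<lambda>i. v ((i + r) mod k)" by (rule rot)
      have "{x, v (r mod 4)} \<in> E" "{x, v ((2 + r) mod 4)} \<in> E"
        using r.four_cycle_attachment[OF True, of x] x rl(3,4)
        unfolding l rotation_image by (simp_all add: True)
      moreover have "r mod 4 = 0 \<and> (2 + r) mod 4 = 2 \<or> r mod 4 = 1 \<and> (2 + r) mod 4 = 3 \<or>
        r mod 4 = 2 \<and> (2 + r) mod 4 = 0 \<or> r mod 4 = 3 \<and> (2 + r) mod 4 = 1" by presburger
      ultimately show ?thesis by auto
    qed
    have "card (v ` {..<k}) \<le> 4" using card_image_le[of "{..<k}" v] True by simp
    then have "2 \<le> card (V - v ` {..<k})"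
      using diff_card_le_card_Diff[of "v ` {..<k}" V] assms(2) by simp
    then obtain S where "S \<subseteq> V - v ` {..<k}" "card S = 2" by (rule obtain_subset_with_card_n)
    then obtain x y where xy: "x \<in> V - v ` {..<k}" "y \<in> V - v ` {..<k}" "x \<noteq> y"
      by (auto simp: card_2_iff)
    have mixed: False if xy: "x \<in> V - v ` {..<k}" "y \<in> V - v ` {..<k}" "x \<noteq> y"
      and "{x, v 0} \<in> E" "{x, v 2} \<in> E" "{y, v 1} \<in> E" "{y, v 3} \<in> E" for x y
    proof -
      \<comment> \<open>The six-cycle runs through \<open>x\<close> and \<open>y\<close> and the two cycle edges \<open>{v 1, v 2}\<close> and \<open>{v 0, v 3}\<close>.\<close>
      let ?x = "(!) [v 0, x, v 2, v 1, y, v 3]"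
      have cyc: "{v 1, v 2} \<in> E" "{v 0, v 3} \<in> E"
        using branch_cycle_touch(2)[OF cycle] branch_cycle_close[OF cycle, of 3] True
        by (simp_all add: touch_def)
      have four: "{..<4} = {0, 1, 2, 3 :: nat}" and six: "{..<6} = {0, 1, 2, 3, 4, 5 :: nat}"
        by auto
      have "branch_cycle V E 6 (\<lambda>i. {?x i})"
      proof (rule branch_cycleI)
        show "branch_sets V E {..<6} (\<lambda>i. {?x i})"
          using B(2) xy unfolding branch_sets_def True four six by auto
        show "touch E {?x (6 - 1)} {?x 0}" using cyc(2) by (simp add: touch_def insert_commute)
        fix i :: nat assume "Suc i < 6"
        then consider "i = 0" | "i = 1" | "i = 2" | "i = 3" | "i = 4" by linarith
        then show "touch E {?x i} {?x (Suc i)}"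
          using cyc that(4-7) by cases (simp_all add: touch_def insert_commute)
      qed simp
      from branch_cycle_merge[OF this, of 4 "Suc k"] show False using no_longer True by auto
    qed
    consider "{x, v 0} \<in> E" "{x, v 2} \<in> E" "{y, v 0} \<in> E" "{y, v 2} \<in> E"
      | "{x, v 1} \<in> E" "{x, v 3} \<in> E" "{y, v 1} \<in> E" "{y, v 3} \<in> E"
      using opposite[OF xy(1)] opposite[OF xy(2)] mixed[OF xy] mixed[OF xy(2,1)] xy(3) by blast
    then show ?thesis
    proof cases
      case 1
      then show ?thesis using colorable_K24[of v x y] cycle xy True by simp
    next
      case 2
      interpret r: longest_cycle V E k "\<lambda>i. v ((i + 1) mod k)" by (rule rot)
      show ?thesis
        using colorable_K24[of "\<lambda>i. v ((i + 1) mod k)" x y] r.cycle xy 2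
          rotation_image[of v 1 k] True by simp
    qed
  next
    case False
    then have k: "5 \<le> k" using \<open>4 \<le> k\<close> by simp
    let ?D = "component E (V - v ` {..<k}) d"
    obtain r l where rl: "2 \<le> l" "2 * l \<le> k" "touch E ?D {v (r mod k)}"
      "touch E ?D {v ((l + r) mod k)}"
      using detour[OF d] by blast
    define v' where "v' i = v ((i + r) mod k)" for i
    have cyc: "branch_cycle V E k (\<lambda>i. {v' i})" unfolding v'_def by (rule branch_cycle_rotate[OF cycle])
    have touch: "touch E ?D {v' 0}" "touch E ?D {v' l}" using rl by (simp_all add: v'_def)
    have im: "v' ` {..<k} = v ` {..<k}" unfolding v'_def by (rule rotation_image)
    have D: "?D \<noteq> {}" "?D \<subseteq> V - v ` {..<k}" "conn E ?D"
      using component_subset[OF d] conn_component[OF d] by auto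
    have disj: "v' i \<notin> ?D" if "i < k" for i
    proof -
      have "v' i \<in> v ` {..<k}" unfolding im[symmetric] using that by simp
      then show ?thesis using D(2) by blast
    qed
    show ?thesis
    proof (cases "l = 2")
      case True
      show ?thesis
        by (rule colorable_detour[OF cyc k D(1) _ D(3)])
          (use D(2) disj touch touch_sym True in auto)
    next
      case False
      let ?B = "(\<lambda>i. {v' i})(0 := {v' 0} \<union> ?D)"
      have "branch_sets V E {..<k} ?B"
      proof (rule branch_sets_update)
        show "branch_sets V E {..<k} (\<lambda>i. {v' i})" using branch_cycleD(2)[OF cyc] .
        show "conn E ({v' 0} \<union> ?D)" using D(3) touch_sym[OF touch(1)] by (intro conn_Un) auto
        show "{v' 0} \<union> ?D \<subseteq> V" using D(2) branch_setsD(2)[OF branch_cycleD(2)[OF cyc], of 0] k by auto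
        show "{v' i} \<inter> ({v' 0} \<union> ?D) = {}" if "i \<in> {..<k}" "i \<noteq> 0" for i
          using disj[of i] branch_sets_eq[OF branch_cycleD(2)[OF cyc], of i 0 "v' i"] that by auto
      qed (use k in auto)
      moreover have "touch E (?B i) (?B (Suc i mod k))" if "i < k" for i
        by (rule touch_mono[OF branch_cycleD(3)[OF cyc that]]) auto
      ultimately have "branch_cycle V E k ?B" using k by (simp add: branch_cycle_def)
      moreover have "touch E (?B 0) (?B l)"
        by (rule touch_mono[OF touch(2)]) (use rl(1) in auto)
      ultimately show ?thesis
        using rl(1,2) False by (intro colorable_long_chord[of k ?B l]) simp_all
    qed
  qed
qed

end

section \<open>Graphs that need one colour more\<close>

lemma linked_tree:
  assumes "finite F" "\<And>e. e \<in> F \<Longrightarrow> finite e" "s \<in> S" "\<And>x. x \<in> S \<Longrightarrow> joined F s x"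
  shows "\<exists>W T. S \<subseteq> W \<and> finite W \<and> T \<subseteq> F \<and> T \<subseteq> Pow W \<and> card W = Suc (card T) \<and>
    (\<forall>x\<in>W. \<forall>y\<in>W. joined T x y)"
proof -
  define W where "W = component F UNIV s"
  have S: "S \<subseteq> W" using assms(4) by (auto simp: W_def component_def)
  have "W \<subseteq> insert s (\<Union>F)"
  proof
    fix y assume "y \<in> W"
    then have "joined F s y" by (simp add: W_def component_def)
    then show "y \<in> insert s (\<Union>F)" by (induction rule: joined_induct) auto
  qed
  then have fin: "finite W" by (rule finite_subset) (use assms(1,2) in auto)
  have "conn F W" unfolding W_def by (rule conn_component) simp
  moreover have "W \<noteq> {}" using S assms(3) by blast
  from conn_spanning_edges[OF fin calculation this] obtain T where T: "T \<subseteq> F" "T \<subseteq> Pow W"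
    "card T = card W - 1" "\<forall>x\<in>W. \<forall>y\<in>W. joined T x y"
    by (elim exE conjE)
  have "card W = Suc (card T)" using T(3) \<open>W \<noteq> {}\<close> fin by (simp add: card_gt_0_iff)
  then show ?thesis using S fin T by (intro exI[of _ W] exI[of _ T]) simp
qed

text \<open>A rainbow tree has at most \<open>k\<close> edges, hence at most \<open>k + 1\<close> vertices.\<close>

lemma rainbow_trees:
  assumes "colorable V E k" "finite E" "\<And>e. e \<in> E \<Longrightarrow> finite e"
  shows "\<exists>c :: 'a set \<Rightarrow> nat. c ` E \<subseteq> {..<k} \<and> (\<forall>S\<subseteq>V. card S = 3 \<longrightarrow>
    (\<exists>W T. S \<subseteq> W \<and> finite W \<and> card W \<le> Suc k \<and> card W = Suc (card T) \<and> T \<subseteq> E \<and> T \<subseteq> Pow W \<and>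
      inj_on c T \<and> (\<forall>x\<in>W. \<forall>y\<in>W. joined T x y)))"
proof -
  obtain c where c: "c ` E \<subseteq> {..<k}"
    "\<And>S. S \<subseteq> V \<Longrightarrow> card S = 3 \<Longrightarrow> \<exists>F\<subseteq>E. inj_on c F \<and> (\<forall>x\<in>S. \<forall>y\<in>S. joined F x y)"
    using assms(1) unfolding colorable_def by auto
  have "\<exists>W T. S \<subseteq> W \<and> finite W \<and> card W \<le> Suc k \<and> card W = Suc (card T) \<and> T \<subseteq> E \<and> T \<subseteq> Pow W \<and>
      inj_on c T \<and> (\<forall>x\<in>W. \<forall>y\<in>W. joined T x y)" if S: "S \<subseteq> V" "card S = 3" for S
  proof -
    obtain F where F: "F \<subseteq> E" "inj_on c F" "\<And>x y. x \<in> S \<Longrightarrow> y \<in> S \<Longrightarrow> joined F x y"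
      using c(2)[OF S] by auto
    have "S \<noteq> {}" using S(2) by auto
    then obtain s where s: "s \<in> S" by blast
    have "finite F" using F(1) assms(2) finite_subset by blast
    moreover have "finite e" if "e \<in> F" for e using F(1) assms(3) that by blast
    ultimately obtain W T where T: "S \<subseteq> W" "finite W" "T \<subseteq> F" "T \<subseteq> Pow W" "card W = Suc (card T)"
      "\<forall>x\<in>W. \<forall>y\<in>W. joined T x y"
      using linked_tree[of F s S] s F(3)[OF s] by auto
    have inj: "inj_on c T" using F(2) T(3) inj_on_subset by blast
    have "c ` T \<subseteq> {..<k}" using c(1) F(1) T(3) by blast
    from card_inj_on_le[OF inj this] have "card T \<le> k" by simp
    then show ?thesis using T F(1) inj by (intro exI[of _ W] exI[of _ T]) simp
  qed
  then show ?thesis using c(1) by (intro exI[of _ c]) simp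
qed

lemma not_colorable_1:
  assumes "3 \<le> card V" "finite E" "\<And>e. e \<in> E \<Longrightarrow> finite e"
  shows "\<not> colorable V E 1"
proof
  assume "colorable V E 1"
  from rainbow_trees[OF this assms(2,3)] obtain c where c: "\<forall>S\<subseteq>V. card S = 3 \<longrightarrow>
    (\<exists>W. S \<subseteq> W \<and> finite W \<and> card W \<le> Suc 1)" by meson
  obtain S where S: "S \<subseteq> V" "card S = 3" by (rule obtain_subset_with_card_n[OF assms(1)])
  then obtain W where "S \<subseteq> W" "finite W" "card W \<le> Suc 1" using c by blast
  then show False using card_mono[of W S] S(2) by simp
qed

lemma simple_complete_graph: "simple_graph (complete_graph n)"
  by (auto simp: simple_graph_def complete_graph_def)

lemma simple_K5_minus_edge: "simple_graph K5_minus_edge"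
  using simple_complete_graph[of 5] by (auto simp: simple_graph_def K5_minus_edge_def)

lemma simple_three_sun: "simple_graph three_sun"
  by (auto simp: simple_graph_def three_sun_def)

lemma simple_cycle_graph:
  assumes "2 \<le> n"
  shows "simple_graph (cycle_graph n)"
proof -
  have "card {i, Suc i mod n} = 2" if "i < n" for i
    using that assms by (cases "Suc i = n") auto
  then show ?thesis using assms by (auto simp: simple_graph_def cycle_graph_def)
qed

text \<open>With two colours a tree on a triple spans nothing else, so the edges inside a triple may not
  all have the same colour. The edges from \<open>0\<close> to \<open>2, 3, 4\<close> must nevertheless repeat a colour.\<close>

lemma not_colorable_K5_minus_edge: "\<not> colorable (verts K5_minus_edge) (edges K5_minus_edge) 2"
proof
  let ?E = "edges K5_minus_edge"
  have E: "{x, y} \<in> ?E \<longleftrightarrow> x < 5 \<and> y < 5 \<and> x \<noteq> y \<and> {x, y} \<noteq> {0, 1}" for x y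
    by (cases "x = y") (auto simp: K5_minus_edge_def complete_graph_def)
  have V: "verts K5_minus_edge = {..<5}" by (simp add: K5_minus_edge_def complete_graph_def)
  assume "colorable (verts K5_minus_edge) ?E 2"
  then have "colorable {..<5} ?E 2" by (simp add: V)
  moreover have fin: "finite ?E" using finite_edges[OF simple_K5_minus_edge] .
  moreover have "finite e" if "e \<in> ?E" for e
    using simple_graph_edgeE[OF simple_K5_minus_edge that] by (metis finite.simps)
  ultimately obtain c :: "nat set \<Rightarrow> nat" where c: "c ` ?E \<subseteq> {..<2}"
    and trees: "\<forall>S\<subseteq>{..<5}. card S = 3 \<longrightarrow> (\<exists>W T. S \<subseteq> W \<and> finite W \<and> card W \<le> Suc 2 \<and>
      card W = Suc (card T) \<and> T \<subseteq> ?E \<and> T \<subseteq> Pow W \<and> inj_on c T)"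
    using rainbow_trees[of "{..<5}" ?E 2] by meson
  have nonmono: False if xyz: "x < 5" "y < 5" "z < 5" "x \<noteq> y" "y \<noteq> z" "x \<noteq> z"
    and mono: "\<And>e. e \<in> ?E \<Longrightarrow> e \<in> {{x, y}, {y, z}, {x, z}} \<Longrightarrow> c e = i" for x y z i
  proof -
    have S: "{x, y, z} \<subseteq> {..<5}" "card {x, y, z} = 3" using xyz by auto
    then obtain W T where T: "{x, y, z} \<subseteq> W" "finite W" "card W \<le> Suc 2" "card W = Suc (card T)"
      "T \<subseteq> ?E" "T \<subseteq> Pow W" "inj_on c T"
      using trees by meson
    have W: "W = {x, y, z}" using card_seteq[OF T(2,1)] T(3) S(2) by simp
    have "c e = i" if e: "e \<in> T" for e
    proof -
      have "e \<in> ?E" "e \<subseteq> {x, y, z}" using e T(5,6) W by auto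
      moreover obtain p q where "e = {p, q}" "p \<noteq> q"
        using simple_graph_edgeE[OF simple_K5_minus_edge \<open>e \<in> ?E\<close>] by metis
      ultimately have "e \<in> {{x, y}, {y, z}, {x, z}}" by auto
      then show ?thesis using mono \<open>e \<in> ?E\<close> by blast
    qed
    then have "c ` T \<subseteq> {i}" by auto
    from card_inj_on_le[OF T(7) this] have "card T \<le> 1" by simp
    then show False using T(4) W S(2) by simp
  qed
  have two: "c {x, y} < 2" if "{x, y} \<in> ?E" for x y using c that by auto
  \<comment> \<open>If \<open>{0, u}\<close> and \<open>{0, w}\<close> had the same colour, then the other colour would be forced on the
    whole triangle \<open>1, u, w\<close>.\<close>
  have neq: "c {0, u} \<noteq> c {0, w}" if uw: "u \<in> {2, 3, 4}" "w \<in> {2, 3, 4}" "u \<noteq> w" for u w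
  proof
    assume eq: "c {0, u} = c {0, w}"
    have lt: "u < 5" "w < 5" "0 \<noteq> u" "1 \<noteq> u" "0 \<noteq> w" "1 \<noteq> w" using uw by auto
    have "c {u, w} \<noteq> c {0, u}"
      using nonmono[of 0 u w "c {0, u}"] lt uw(3) eq by auto
    moreover have "c {1, u} \<noteq> c {0, u}"
      using nonmono[of 0 u 1 "c {0, u}"] lt E[of 0 1] by (auto simp: insert_commute)
    moreover have "c {1, w} \<noteq> c {0, u}"
      using nonmono[of 0 w 1 "c {0, u}"] lt E[of 0 1] eq by (auto simp: insert_commute)
    moreover have "c {1, u} < 2" "c {1, w} < 2" "c {u, w} < 2" "c {0, u} < 2"
      using lt uw(3) by (intro two, simp add: E doubleton_eq_iff)+
    ultimately have "c {1, u} = c {u, w}" "c {1, w} = c {u, w}" by linarith+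
    then show False using nonmono[of 1 u w "c {u, w}"] lt uw(3) by auto
  qed
  have "c {0, 2} < 2" "c {0, 3} < 2" "c {0, 4} < 2"
    by (intro two, simp add: E doubleton_eq_iff)+
  then show False using neq[of 2 3] neq[of 2 4] neq[of 3 4] by auto
qed

text \<open>The vertices \<open>1, 3, 5\<close> of degree two are pairwise nonadjacent and have no common neighbour, so a
  tree containing them needs two of the vertices \<open>2, 4, 6\<close>, which makes five vertices.\<close>

lemma not_colorable_three_sun: "\<not> colorable (verts three_sun) (edges three_sun) 3"
proof
  assume col: "colorable (verts three_sun) (edges three_sun) 3"
  have "finite e" if "e \<in> edges three_sun" for e
    using simple_graph_edgeE[OF simple_three_sun that] by (metis finite.simps)
  from rainbow_trees[OF col finite_edges[OF simple_three_sun] this]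
  have "\<forall>S\<subseteq>verts three_sun. card S = 3 \<longrightarrow> (\<exists>W T. S \<subseteq> W \<and> finite W \<and> card W \<le> Suc 3 \<and>
      T \<subseteq> edges three_sun \<and> T \<subseteq> Pow W \<and> (\<forall>x\<in>W. \<forall>y\<in>W. joined T x y))" by meson
  moreover have "{1, 3, 5} \<subseteq> verts three_sun" "card {1, 3, 5 :: nat} = 3"
    by (auto simp: three_sun_def)
  ultimately obtain W T where W: "{1, 3, 5} \<subseteq> W" "finite W" "card W \<le> Suc 3"
    and T: "T \<subseteq> edges three_sun" "T \<subseteq> Pow W" "\<forall>x\<in>W. \<forall>y\<in>W. joined T x y" by meson
  have nb: "\<exists>b\<in>W. {x, b} \<in> edges three_sun" if "x \<in> W" "y \<in> W" "y \<noteq> x" for x y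
  proof -
    have "joined T x y" "y \<notin> {x}" using that T(3) by auto
    from joined_crosses[OF this(1) singletonI this(2)] obtain b where "{x, b} \<in> T" by auto
    then show ?thesis using T(1,2) by auto
  qed
  have "2 \<in> W \<or> 6 \<in> W" using nb[of 1 3] W(1) by (auto simp: three_sun_def doubleton_eq_iff)
  moreover have "2 \<in> W \<or> 4 \<in> W" using nb[of 3 1] W(1) by (auto simp: three_sun_def doubleton_eq_iff)
  moreover have "4 \<in> W \<or> 6 \<in> W" using nb[of 5 1] W(1) by (auto simp: three_sun_def doubleton_eq_iff)
  ultimately have "{1, 3, 5, 2, 4} \<subseteq> W \<or> {1, 3, 5, 2, 6} \<subseteq> W \<or> {1, 3, 5, 4, 6} \<subseteq> W"
    using W(1) by auto
  then have "card {1, 3, 5, 2, 4 :: nat} \<le> card W \<or> card {1, 3, 5, 2, 6 :: nat} \<le> card W \<or>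
      card {1, 3, 5, 4, 6 :: nat} \<le> card W" using card_mono[OF W(2)] by meson
  then show False using W(3) by simp
qed

text \<open>Without the edges at \<open>i\<close> and \<open>j\<close> the cycle falls apart into two arcs, one of them with vertices
  \<open>i + 1, ..., j\<close>.\<close>

lemma cycle_separated:
  assumes F: "F \<subseteq> edges (cycle_graph n)" and ij: "i < j" "j < n"
    and missing: "{i, Suc i mod n} \<notin> F" "{j, Suc j mod n} \<notin> F"
    and "joined F x y" "x \<in> {i<..j}"
  shows "y \<in> {i<..j}"
  using assms(6)
proof (induction rule: joined_induct)
  case (step y z)
  obtain t where t: "t < n" "{y, z} = {t, Suc t mod n}"
    using step.hyps(2) F by (auto simp: cycle_graph_def)
  have "t \<noteq> i" "t \<noteq> j" using t(2) step.hyps(2) missing by metis+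
  moreover have "y = t \<and> z = Suc t mod n \<or> y = Suc t mod n \<and> z = t"
    using t(2) by (auto simp: doubleton_eq_iff)
  moreover have "Suc t mod n = (if Suc t = n then 0 else Suc t)" using t(1) by simp
  ultimately show ?case using step.IH ij by (auto split: if_splits)
qed (use assms(7) in simp)

text \<open>Three edges repeat the colour of an earlier edge. If two of them repeat the same edge, three
  edges of one colour arise, and every rainbow set misses two of them; the triple is chosen so that each arc
  contains one. Otherwise there are three disjoint pairs of equally coloured edges, and every rainbow set misses at least three
  of these six edges; the triple is chosen so that each arc contains two of the six. Either way missing edges in
  two arcs separate the triple.\<close>

lemma not_colorable_cycle_graph:
  assumes "4 \<le> n"
  shows "\<not> colorable (verts (cycle_graph n)) (edges (cycle_graph n)) (n - 3)"
proof
  let ?e = "\<lambda>i. {i, Suc i mod n}" and ?E = "edges (cycle_graph n)"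
  assume "colorable (verts (cycle_graph n)) ?E (n - 3)"
  then obtain c :: "nat set \<Rightarrow> nat" where c: "c ` ?E \<subseteq> {..<n - 3}"
    and col: "\<And>S. S \<subseteq> {..<n} \<Longrightarrow> card S = 3 \<Longrightarrow> \<exists>F\<subseteq>?E. inj_on c F \<and> (\<forall>x\<in>S. \<forall>y\<in>S. joined F x y)"
    unfolding colorable_def by (auto simp: cycle_graph_def)
  have e_E: "?e i \<in> ?E" if "i < n" for i using that by (auto simp: cycle_graph_def)
  have e_inj: "?e i \<noteq> ?e j" if "i < n" "j < n" "i \<noteq> j" for i j
  proof -
    have "Suc t mod n = (if Suc t = n then 0 else Suc t)" if "t < n" for t using that by simp
    then show ?thesis using that assms by (auto simp: doubleton_eq_iff split: if_splits)
  qed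
  have clash: "?e i \<notin> F \<or> ?e j \<notin> F"
    if "inj_on c F" "i < n" "j < n" "i \<noteq> j" "c (?e i) = c (?e j)" for F i j
    using inj_onD[OF that(1,5)] e_inj[OF that(2-4)] by blast
  \<comment> \<open>\<open>rep i\<close> is the first edge with the colour of edge \<open>i\<close>, and \<open>R\<close> has one edge of each colour.\<close>
  define rep where "rep i = (LEAST j. c (?e j) = c (?e i))" for i
  have rep_c: "c (?e (rep i)) = c (?e i)" for i unfolding rep_def by (rule LeastI) simp
  have rep_le: "rep i \<le> i" for i unfolding rep_def by (rule Least_le) simp
  have rep_rep: "rep (rep i) = rep i" for i unfolding rep_def[of "rep i"] rep_c by (simp add: rep_def)
  define R where "R = {i \<in> {..<n}. rep i = i}"
  have "inj_on (\<lambda>i. c (?e i)) R"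
  proof (rule inj_onI)
    fix i j assume "i \<in> R" "j \<in> R" "c (?e i) = c (?e j)"
    then have "rep i = rep j" unfolding rep_def by simp
    then show "i = j" using \<open>i \<in> R\<close> \<open>j \<in> R\<close> by (simp add: R_def)
  qed
  moreover have "(\<lambda>i. c (?e i)) ` R \<subseteq> {..<n - 3}" using c e_E unfolding R_def by blast
  from card_inj_on_le[OF calculation this] have "card R \<le> n - 3" by simp
  moreover have "card ({..<n} - R) = n - card R" by (subst card_Diff_subset) (auto simp: R_def)
  ultimately have "3 \<le> card ({..<n} - R)" using assms by simp
  then obtain T where T: "T \<subseteq> {..<n} - R" "card T = 3" by (rule obtain_subset_with_card_n)
  have Tn: "t < n" "rep t < n" "rep t \<noteq> t" if "t \<in> T" for t
    using T(1) that rep_le[of t] by (auto simp: R_def)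
  have finT: "finite T" using T(2) by (simp add: card_ge_0_finite)
  show False
  proof (cases "inj_on rep T")
    case False
    then obtain s t where st: "s \<in> T" "t \<in> T" "s \<noteq> t" "rep s = rep t" by (auto simp: inj_on_def)
    let ?S = "{s, t, rep s}"
    have "?S \<subseteq> {..<n}" "card ?S = 3" using st Tn[OF st(1)] Tn[OF st(2)] by auto
    then obtain F where F: "F \<subseteq> ?E" "inj_on c F" "\<And>x y. x \<in> ?S \<Longrightarrow> y \<in> ?S \<Longrightarrow> joined F x y"
      using col by meson
    \<comment> \<open>The edge at position \<open>p\<close> starts at vertex \<open>p\<close>, so the positions of the three edges serve as the triple.\<close>
    have sep: False if pq: "p \<in> ?S" "q \<in> ?S" "p < q" "?e p \<notin> F" "?e q \<notin> F" for p q
    proof -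
      have "q < n" using pq(2) \<open>?S \<subseteq> {..<n}\<close> by blast
      from cycle_separated[OF F(1) pq(3) this pq(4,5) F(3)[OF pq(2,1)]] show False using pq(3) by simp
    qed
    have same: "c (?e p) = c (?e q)" if "p \<in> ?S" "q \<in> ?S" for p q
      using that rep_c[of s] rep_c[of t] st(4) by auto
    have miss: "?e p \<notin> F \<or> ?e q \<notin> F" if "p \<in> ?S" "q \<in> ?S" "p \<noteq> q" for p q
      using clash[OF F(2) _ _ that(3) same[OF that(1,2)]] that \<open>?S \<subseteq> {..<n}\<close> by blast
    have no2: "?e p \<in> F \<or> ?e q \<in> F" if "p \<in> ?S" "q \<in> ?S" "p \<noteq> q" for p q
      using sep[of p q] sep[of q p] that by (metis nat_neq_iff)
    show False
      using miss[of s t] miss[of s "rep s"] miss[of t "rep s"] no2[of s t] no2[of s "rep s"]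
        no2[of t "rep s"] st(3) Tn[OF st(1)] Tn[OF st(2)] st(4) by auto
  next
    case True
    let ?X = "T \<union> rep ` T"
    have disj: "T \<inter> rep ` T = {}" using Tn(3) rep_rep by fastforce
    have "card ?X = card T + card (rep ` T)" using finT disj by (intro card_Un_disjoint) auto
    then have cardX: "card ?X = 6" using card_image[OF True] T(2) by simp
    define xs where "xs = sorted_list_of_set ?X"
    have xs: "set xs = ?X" "length xs = 6" "sorted_wrt (<) xs"
      using finT cardX by (simp_all add: xs_def)
    have mono: "xs ! i < xs ! j" if "i < j" "j < 6" for i j
      using sorted_wrt_nth_less[OF xs(3) that(1)] that(2) xs(2) by simp
    have mono_le: "xs ! i \<le> xs ! j" if "i \<le> j" "j < 6" for i j
      using mono[of i j] that by (cases "i = j") auto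
    have lt: "xs ! i < n" if "i < 6" for i
      using nth_mem[of i xs] that xs(1,2) Tn by auto
    let ?S = "{xs ! 0, xs ! 2, xs ! 4}"
    have "?S \<subseteq> {..<n}" "card ?S = 3"
      using lt mono[of 0 2] mono[of 2 4] mono[of 0 4] by auto
    then obtain F where F: "F \<subseteq> ?E" "inj_on c F" "\<And>x y. x \<in> ?S \<Longrightarrow> y \<in> ?S \<Longrightarrow> joined F x y"
      using col by meson
    \<comment> \<open>Index \<open>i\<close> lies in arc number \<open>i div 2\<close>.\<close>
    define I where "I = {i \<in> {..<6}. ?e (xs ! i) \<notin> F}"
    define m where "m t = (if ?e t \<notin> F then t else rep t)" for t
    have m: "?e (m t) \<notin> F" "m t \<in> ?X" if "t \<in> T" for t
      using clash[OF F(2) Tn(1,2)[OF that] Tn(3)[OF that, symmetric] rep_c[symmetric]] that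
      by (auto simp: m_def)
    have "inj_on m T" using True disj by (auto simp: inj_on_def m_def)
    then have "card (m ` T) = 3" using T(2) by (simp add: card_image)
    moreover have "m ` T \<subseteq> (!) xs ` I"
    proof
      fix x assume "x \<in> m ` T"
      then have "?e x \<notin> F" "x \<in> set xs" using m xs(1) by auto
      then show "x \<in> (!) xs ` I" using xs(2) by (auto simp: I_def in_set_conv_nth)
    qed
    moreover have finI: "finite I" by (simp add: I_def)
    ultimately have "3 \<le> card I"
      by (metis card_image_le card_mono finite_imageI order_trans)
    have "\<exists>i\<in>I. \<exists>j\<in>I. i div 2 < j div 2"
    proof (rule ccontr)
      assume no: "\<not> ?thesis"
      have "I \<noteq> {}" using \<open>3 \<le> card I\<close> by auto
      then obtain i where "i \<in> I" by blast
      then have "I \<subseteq> {2 * (i div 2), Suc (2 * (i div 2))}"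
      proof -
        have "j = 2 * (i div 2) \<or> j = Suc (2 * (i div 2))" if "j \<in> I" for j
        proof -
          have "j div 2 = i div 2" using no that \<open>i \<in> I\<close> by (meson linorder_neqE_nat)
          then show ?thesis by presburger
        qed
        then show ?thesis by blast
      qed
      then have "card I \<le> card {2 * (i div 2), Suc (2 * (i div 2))}" by (intro card_mono) auto
      then show False using \<open>3 \<le> card I\<close> by simp
    qed
    then obtain i j where ij: "i \<in> I" "j \<in> I" "i div 2 < j div 2" by blast
    have ij6: "i < 6" "j < 6" "i < j" using ij by (auto simp: I_def intro: ccontr)
    let ?p = "2 * (i div 2)" and ?q = "2 * (j div 2)"
    have S: "xs ! ?p \<in> ?S" "xs ! ?q \<in> ?S"
    proof -
      have "?p = 0 \<or> ?p = 2 \<or> ?p = 4" using ij6 by presburger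
      then show "xs ! ?p \<in> ?S" by auto
      have "?q = 0 \<or> ?q = 2 \<or> ?q = 4" using ij6 by presburger
      then show "xs ! ?q \<in> ?S" by auto
    qed
    have iq: "i < ?q" "?q \<le> j" "?p \<le> i" using ij(3) by presburger+
    have "xs ! ?q \<in> {xs ! i<..xs ! j}" using mono[of i ?q] mono_le[of ?q j] iq ij6 by simp
    then have "xs ! ?p \<in> {xs ! i<..xs ! j}"
      using cycle_separated[OF F(1) mono[OF ij6(3,2)] lt[OF ij6(2)] _ _ F(3)[OF S(2,1)]] ij(1,2)
      by (simp add: I_def)
    moreover have "xs ! ?p \<le> xs ! i" using mono_le iq ij6 by simp
    ultimately show False by simp
  qed
qed

section \<open>Chords of a Hamiltonian cycle\<close>

context longest_cycle
begin

lemma colorable_rotated_chord: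
  assumes "{v (r mod k), v ((l + r) mod k)} \<in> E" "2 \<le> l" "2 * l \<le> k" "l \<noteq> 2 \<or> 7 \<le> k"
  shows "colorable V E (card V - 3)"
proof -
  note rot = branch_cycle_rotate[OF cycle, of r]
  have touch: "touch E {v ((0 + r) mod k)} {v ((l + r) mod k)}" using assms(1) by (simp add: touch_def)
  show ?thesis
  proof (cases "l = 2")
    case True
    then show ?thesis using colorable_short_chord[OF rot] touch assms(4) by simp
  next
    case False
    then show ?thesis using colorable_long_chord[OF rot touch] assms(2,3) by simp
  qed
qed

text \<open>Of two short chords, one with even and the other with odd ends, either they cross or they are
  parallel; up to rotation these are the two coloured six-cycles with chords.\<close>

lemma colorable_two_chords:
  assumes k: "k = 6" and chord: "{v (r mod 6), v ((2 + r) mod 6)} \<in> E"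
    and other: "{v ((1 + r) mod 6), v ((3 + r) mod 6)} \<in> E \<or> {v ((3 + r) mod 6), v ((5 + r) mod 6)} \<in> E"
  shows "colorable V E (card V - 3)"
proof -
  have rot: "branch_cycle V E 6 (\<lambda>i. {v ((i + r) mod 6)})"
    using branch_cycle_rotate[OF cycle, of r] k by simp
  let ?B = "\<lambda>i. {v ((i + r) mod 6)}"
  have touch: "touch E (?B 0) (?B 2)" "touch E (?B 1) (?B 3) \<or> touch E (?B 3) (?B 5)"
    using chord other by (simp_all add: touch_def)
  note cyc = branch_cycle_touch[OF rot] branch_cycle_close[OF rot, of 5] branch_cycleD(2)[OF rot]
  from touch(2) show ?thesis
  proof
    assume "touch E (?B 1) (?B 3)"
    then show ?thesis using cyc touch(1)
      by (intro colorable_minus_3_if_certificate[OF crossing_chords_certificate, of ?B]) simp_all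
  next
    assume "touch E (?B 3) (?B 5)"
    then show ?thesis using cyc touch(1)
      by (intro colorable_minus_3_if_certificate[OF parallel_chords_certificate, of ?B]) simp_all
  qed
qed

lemma chord_arc:
  assumes "{v i, v j} \<in> E" "i < k" "j < k" "j \<noteq> Suc i mod k" "i \<noteq> Suc j mod k"
  shows "\<exists>r l. 2 \<le> l \<and> 2 * l \<le> k \<and> {r mod k, (l + r) mod k} = {i, j} \<and>
    {v (r mod k), v ((l + r) mod k)} \<in> E"
proof -
  have "v i \<noteq> v j" using edge[OF assms(1)] by (auto simp: doubleton_eq_iff)
  then have "i \<noteq> j" by auto
  then obtain r l where l: "0 < l" "2 * l \<le> k"
    and rl: "r mod k = i \<and> (l + r) mod k = j \<or> r mod k = j \<and> (l + r) mod k = i"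
    using rotation_arc assms(2,3) by blast
  have "l \<noteq> 1"
  proof
    assume "l = 1"
    then have "(l + r) mod k = Suc (r mod k) mod k" by (simp add: mod_Suc_eq)
    then show False using rl assms(4,5) by auto
  qed
  then show ?thesis using rl l assms(1)
    by (intro exI[of _ r] exI[of _ l]) (auto simp: insert_commute)
qed

end


section \<open>Embeddings into the extremal graphs\<close>

text \<open>Up to isomorphism a spanning subgraph of \<open>K\<close>.\<close>

definition embeds :: "'a set \<Rightarrow> 'a set set \<Rightarrow> 'b ugraph \<Rightarrow> bool" where
  "embeds V E K \<longleftrightarrow> (\<exists>h. bij_betw h V (verts K) \<and>
     (\<forall>x\<in>V. \<forall>y\<in>V. {x, y} \<in> E \<longrightarrow> {h x, h y} \<in> edges K))"

lemma embeds_iff_spanning_subgraph: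
  assumes G: "simple_graph G" and K: "simple_graph K"
  shows "embeds (verts G) (edges G) K \<longleftrightarrow> (\<exists>H. spanning_subgraph H K \<and> graph_iso G H)"
proof
  assume "embeds (verts G) (edges G) K"
  then obtain h where h: "bij_betw h (verts G) (verts K)"
    "\<And>x y. x \<in> verts G \<Longrightarrow> y \<in> verts G \<Longrightarrow> {x, y} \<in> edges G \<Longrightarrow> {h x, h y} \<in> edges K"
    unfolding embeds_def by blast
  let ?H = "(verts K, {{h x, h y} | x y. {x, y} \<in> edges G})"
  have sub: "edges ?H \<subseteq> edges K" using h(2) simple_graph_edge[OF G] by auto
  then have "\<forall>e\<in>edges ?H. e \<subseteq> verts K \<and> card e = 2" using K unfolding simple_graph_def by blast
  then have "spanning_subgraph ?H K"
    using K sub unfolding spanning_subgraph_def subgraph_def simple_graph_def by simp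
  moreover have "graph_iso G ?H"
    unfolding graph_iso_def
  proof (intro exI[of _ h] conjI ballI)
    show "bij_betw h (verts G) (verts ?H)" using h(1) by simp
    fix x y assume xy: "x \<in> verts G" "y \<in> verts G"
    have inj: "a = b" if "a \<in> verts G" "b \<in> verts G" "h a = h b" for a b
      using h(1) that by (auto simp: bij_betw_def inj_on_def)
    have "{x, y} \<in> edges G" if "{h x, h y} = {h a, h b}" "{a, b} \<in> edges G" for a b
    proof -
      have "a \<in> verts G" "b \<in> verts G" using simple_graph_edge[OF G that(2)] by auto
      then have "x = a \<and> y = b \<or> x = b \<and> y = a" using that(1) inj xy by (auto simp: doubleton_eq_iff)
      then show ?thesis using that(2) by (auto simp: insert_commute)
    qed
    then show "adj G x y \<longleftrightarrow> adj ?H (h x) (h y)" by (auto simp: adj_def)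
  qed
  ultimately show "\<exists>H. spanning_subgraph H K \<and> graph_iso G H" by (intro exI[of _ ?H]) simp
next
  assume "\<exists>H. spanning_subgraph H K \<and> graph_iso G H"
  then obtain H where H: "verts H = verts K" "edges H \<subseteq> edges K" "graph_iso G H"
    unfolding spanning_subgraph_def subgraph_def by auto
  then obtain h where "bij_betw h (verts G) (verts H)"
    "\<forall>u\<in>verts G. \<forall>v\<in>verts G. adj G u v \<longleftrightarrow> adj H (h u) (h v)"
    unfolding graph_iso_def by (elim exE conjE)
  then show "embeds (verts G) (edges G) K"
    using H(1,2) unfolding embeds_def adj_def by (intro exI[of _ h]) auto
qed

lemma embedsI_indexed:
  fixes v :: "nat \<Rightarrow> 'a"
  assumes v: "bij_betw v {..<n} V" and g: "bij_betw g {..<n} (verts K)"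
    and loop_free: "\<And>x. {x} \<notin> E"
    and edges: "\<And>i j. i < j \<Longrightarrow> j < n \<Longrightarrow> {v i, v j} \<in> E \<Longrightarrow> {g i, g j} \<in> edges K"
  shows "embeds V E K"
proof -
  let ?f = "inv_into {..<n} v"
  have f: "?f x < n" "v (?f x) = x" if "x \<in> V" for x
    using that v by (auto simp: bij_betw_def f_inv_into_f inv_into_into[of _ v "{..<n}", simplified])
  have "bij_betw (g \<circ> ?f) V (verts K)" using bij_betw_inv_into[OF v] g by (rule bij_betw_trans)
  moreover have "{(g \<circ> ?f) x, (g \<circ> ?f) y} \<in> edges K" if xy: "x \<in> V" "y \<in> V" "{x, y} \<in> E" for x y
  proof -
    define i j where "i = ?f x" and "j = ?f y"
    have ij: "i < n" "j < n" "v i = x" "v j = y" using f xy(1,2) by (auto simp: i_def j_def)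
    have "i \<noteq> j" using ij(3,4) xy(3) loop_free[of x] by auto
    then have "{g i, g j} \<in> edges K"
      using edges[of i j] edges[of j i] ij xy(3)
      by (cases rule: linorder_cases[of i j]) (simp_all add: insert_commute)
    then show ?thesis by (simp add: i_def j_def)
  qed
  ultimately show ?thesis unfolding embeds_def by (intro exI[of _ "g \<circ> ?f"]) simp
qed

context two_connected
begin

lemma edges_inside: "{e \<in> E. e \<subseteq> V} = E"
  using edge by blast

lemma finite_E: "finite E"
proof (rule finite_subset)
  show "E \<subseteq> Pow V" using edges_inside by auto
qed (simp add: finite_V)

text \<open>Additional edges keep a colouring valid, so it could be transferred to \<open>K\<close>.\<close>

lemma not_colorable_if_embeds:
  assumes "embeds V E K" "simple_graph K" "\<not> colorable (verts K) (edges K) k"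
  shows "\<not> colorable V E k"
proof
  assume col: "colorable V E k"
  obtain h where h: "bij_betw h V (verts K)"
    "\<And>x y. x \<in> V \<Longrightarrow> y \<in> V \<Longrightarrow> {x, y} \<in> E \<Longrightarrow> {h x, h y} \<in> edges K"
    using assms(1) unfolding embeds_def by blast
  have inside: "{e \<in> edges K. e \<subseteq> verts K} = edges K"
    using assms(2) by (auto simp: simple_graph_def)
  have lift: "joined (edges K) (h x) (h y)" if "joined E x y" for x y
    using that
  proof (induction rule: joined_induct)
    case (step y z)
    have "y \<in> V" "z \<in> V" using edge[OF step.hyps(2)] by (auto simp: doubleton_eq_iff)
    then have "joined (edges K) (h y) (h z)" using h(2) step.hyps(2) by (intro joined_edge) simp
    with step.IH show ?case by (rule joined_trans)
  qed simp
  have "joined (edges K) a b" if "a \<in> h ` V" "b \<in> h ` V" for a b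
    using that lift joined_if_conn[OF conn_V] by auto
  then have conn: "conn (edges K) (verts K)"
    unfolding conn_def inside bij_betw_imp_surj_on[OF h(1)] by simp
  have fin: "finite (verts K)" using assms(2) by (simp add: simple_graph_def)
  have card: "3 \<le> card (verts K)" using order bij_betw_same_card[OF h(1)] by simp
  have "colorable (verts K) (edges K) k"
  proof (rule colorable_embed[OF fin conn card finite_V h(1) _ col])
    fix e assume e: "e \<in> E"
    then obtain x y where "e = {x, y}" "x \<noteq> y" "x \<in> V" "y \<in> V" using edge by blast
    then show "\<exists>u w. e = {u, w} \<and> u \<in> V \<and> w \<in> V \<and> u \<noteq> w \<and> {h u, h w} \<in> edges K"
      using h(2) e by blast
  qed
  then show False using assms(3) by simp
qed

lemma embeds_complete_graph:
  assumes "card V = n"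
  shows "embeds V E (complete_graph n)"
proof -
  obtain h where h: "bij_betw h V {..<n}"
    using ex_bij_betw_finite_nat[OF finite_V] assms by (auto simp: atLeast0LessThan)
  have "{h x, h y} \<in> edges (complete_graph n)" if "x \<in> V" "y \<in> V" "{x, y} \<in> E" for x y
  proof -
    have "x \<noteq> y" using edge[OF that(3)] by (auto simp: doubleton_eq_iff)
    then have "h x \<noteq> h y" using h that(1,2) by (auto simp: bij_betw_def inj_on_def)
    then show ?thesis using h that(1,2) by (auto simp: complete_graph_def bij_betw_def)
  qed
  then show ?thesis unfolding embeds_def
    using h by (intro exI[of _ h]) (simp add: complete_graph_def)
qed

text \<open>Two nonadjacent vertices are mapped to the ends of the missing edge; without them the graph is
  \<open>K\<^sub>5\<close>, whose edges split into two five-cycles.\<close>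

lemma five_vertices:
  assumes n: "card V = 5" and "\<not> colorable V E 2"
  shows "embeds V E K5_minus_edge"
proof -
  obtain f :: "nat \<Rightarrow> 'a" where f: "bij_betw f {..<5} V"
    using ex_bij_betw_nat_finite[OF finite_V] n by (auto simp: atLeast0LessThan)
  have bs: "branch_sets V E {..<5} (\<lambda>i. {f i})"
    using f by (auto simp: branch_sets_def bij_betw_def inj_on_def)
  have "\<exists>x\<in>V. \<exists>y\<in>V. x \<noteq> y \<and> {x, y} \<notin> E"
  proof (rule ccontr)
    assume "\<not> ?thesis"
    then have "touch E {f i} {f j}" if "i < 5" "j < 5" "i \<noteq> j" for i j
      using f that by (auto simp: touch_def bij_betw_def inj_on_def)
    then have "colorable V E (2 + (card V - 5))"
      by (intro colorable_if_certificate[OF K5_certificate finite_V conn_V _ bs]) simp_all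
    then show False using assms by simp
  qed
  then obtain x y where xy: "x \<in> V" "y \<in> V" "x \<noteq> y" "{x, y} \<notin> E" by blast
  have "card (V - {x, y}) = 3" using n xy finite_V by (simp add: card_Diff_subset)
  moreover have "card {2, 3, 4 :: nat} = 3" by simp
  ultimately obtain g where g: "bij_betw g (V - {x, y}) {2, 3, 4 :: nat}"
    using finite_same_card_bij[of "V - {x, y}" "{2, 3, 4 :: nat}"] finite_V by auto
  define h where "h z = (if z = x then 0 else if z = y then 1 else g z)" for z
  have "bij_betw h ({x, y} \<union> (V - {x, y})) ({0, 1} \<union> {2, 3, 4})"
  proof (rule bij_betw_combine)
    show "bij_betw h {x, y} {0, 1}" using xy(3) by (auto simp: bij_betw_def h_def)
    show "bij_betw h (V - {x, y}) {2, 3, 4}"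
      using g by (rule bij_betw_cong[THEN iffD1, rotated]) (simp add: h_def)
  qed auto
  moreover have "{x, y} \<union> (V - {x, y}) = V" using xy by auto
  moreover have "{0, 1} \<union> {2, 3, 4} = {..<5 :: nat}" by auto
  ultimately have h: "bij_betw h V {..<5}" by simp
  have h_eq: "a = b" if "a \<in> V" "b \<in> V" "h a = h b" for a b
    using h that by (auto simp: bij_betw_def inj_on_def)
  have hx: "h x = 0" "h y = 1" using xy(3) by (auto simp: h_def)
  have "{h a, h b} \<in> edges K5_minus_edge" if ab: "a \<in> V" "b \<in> V" "{a, b} \<in> E" for a b
  proof -
    have "a \<noteq> b" using edge[OF ab(3)] by (auto simp: doubleton_eq_iff)
    then have "h a \<noteq> h b" using h_eq ab by blast
    moreover have "h a < 5" "h b < 5" using h ab by (auto simp: bij_betw_def)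
    moreover have "{h a, h b} \<noteq> {0, 1}"
    proof
      assume "{h a, h b} = {0, 1}"
      then have "a = x \<and> b = y \<or> a = y \<and> b = x"
        using h_eq ab xy unfolding hx[symmetric] doubleton_eq_iff by blast
      then show False using ab(3) xy(4) by (auto simp: insert_commute)
    qed
    ultimately show ?thesis by (simp add: K5_minus_edge_def complete_graph_def)
  qed
  then show ?thesis unfolding embeds_def
    using h by (intro exI[of _ h]) (simp add: K5_minus_edge_def complete_graph_def)
qed

end

context longest_cycle
begin

text \<open>Only chords between vertices at distance two remain. A chord with even ends and one with odd ends
  cannot coexist, so all chords lie in one triangle, which is placed on \<open>2, 4, 6\<close>.\<close>

lemma six_cycle_embeds_three_sun:
  assumes k: "k = 6" and V: "V = v ` {..<k}" and not_col: "\<not> colorable V E (card V - 3)"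
  shows "embeds V E three_sun"
proof -
  have v: "bij_betw v {..<6} V" using V k cycle_inj by (auto simp: bij_betw_def inj_on_def)
  have two: "\<not> ({v (r mod 6), v ((2 + r) mod 6)} \<in> E \<and>
      ({v ((1 + r) mod 6), v ((3 + r) mod 6)} \<in> E \<or> {v ((3 + r) mod 6), v ((5 + r) mod 6)} \<in> E))" for r
    using colorable_two_chords[OF k] not_col by blast
  have "\<not> {v (r mod k), v ((3 + r) mod k)} \<in> E" for r
    using colorable_rotated_chord[of r 3] not_col k by auto
  from this[of 0] this[of 1] this[of 2]
  have long: "{v 0, v 3} \<notin> E" "{v 1, v 4} \<notin> E" "{v 2, v 5} \<notin> E" using k by simp_all
  have short: "{v 1, v 3} \<notin> E \<and> {v 3, v 5} \<notin> E \<and> {v 1, v 5} \<notin> E \<or>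
      {v 0, v 2} \<notin> E \<and> {v 2, v 4} \<notin> E \<and> {v 0, v 4} \<notin> E"
  proof -
    have "\<not> ({v 0, v 2} \<in> E \<and> ({v 1, v 3} \<in> E \<or> {v 3, v 5} \<in> E))" using two[of 0] by simp
    moreover have "\<not> ({v 1, v 3} \<in> E \<and> ({v 2, v 4} \<in> E \<or> {v 4, v 0} \<in> E))" using two[of 1] by (simp del: One_nat_def)
    moreover have "\<not> ({v 2, v 4} \<in> E \<and> ({v 3, v 5} \<in> E \<or> {v 5, v 1} \<in> E))" using two[of 2] by simp
    moreover have "\<not> ({v 3, v 5} \<in> E \<and> ({v 4, v 0} \<in> E \<or> {v 0, v 2} \<in> E))" using two[of 3] by simp
    moreover have "\<not> ({v 4, v 0} \<in> E \<and> ({v 5, v 1} \<in> E \<or> {v 1, v 3} \<in> E))" using two[of 4] by simp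
    moreover have "\<not> ({v 5, v 1} \<in> E \<and> ({v 0, v 2} \<in> E \<or> {v 2, v 4} \<in> E))" using two[of 5] by simp
    moreover have "{v 5, v 1} = {v 1, v 5}" "{v 4, v 0} = {v 0, v 4}" by auto
    ultimately show ?thesis by metis
  qed
  have loop_free: "{x} \<notin> E" for x using edge[of "{x}"] by auto
  have cases: "i = 0 \<and> (j = 1 \<or> j = 2 \<or> j = 3 \<or> j = 4 \<or> j = 5) \<or>
      i = 1 \<and> (j = 2 \<or> j = 3 \<or> j = 4 \<or> j = 5) \<or> i = 2 \<and> (j = 3 \<or> j = 4 \<or> j = 5) \<or>
      i = 3 \<and> (j = 4 \<or> j = 5) \<or> i = 4 \<and> j = 5" if ij: "i < j" "j < 6" for i j :: nat
  proof -
    have "j = 1 \<or> j = 2 \<or> j = 3 \<or> j = 4 \<or> j = 5" using ij by linarith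
    moreover have "i = 0 \<or> i = 1 \<or> i = 2 \<or> i = 3 \<or> i = 4" using ij by linarith
    ultimately show ?thesis using ij(1) by (elim disjE) simp_all
  qed
  have sun: "{1, 2} \<in> edges three_sun" "{2, 3} \<in> edges three_sun" "{3, 4} \<in> edges three_sun"
    "{4, 5} \<in> edges three_sun" "{5, 6} \<in> edges three_sun" "{6, 1} \<in> edges three_sun"
    "{1, 6} \<in> edges three_sun" "{2, 1} \<in> edges three_sun"
    "{2, 4} \<in> edges three_sun" "{4, 6} \<in> edges three_sun" "{2, 6} \<in> edges three_sun"
    unfolding three_sun_def by (simp_all add: insert_commute)
  have six: "{..<6} = {0, 1, 2, 3, 4, 5 :: nat}" by auto
  from short show ?thesis
  proof
    assume no: "{v 1, v 3} \<notin> E \<and> {v 3, v 5} \<notin> E \<and> {v 1, v 5} \<notin> E"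
    let ?g = "(!) [2, 3, 4, 5, 6, 1 :: nat]"
    have g: "bij_betw ?g {..<6} (verts three_sun)"
      by (auto simp: bij_betw_def inj_on_def six three_sun_def)
    have "{?g i, ?g j} \<in> edges three_sun" if "i < j" "j < 6" "{v i, v j} \<in> E" for i j
      using cases[OF that(1,2)] that(3) no long
      by (elim disjE conjE) (simp_all add: sun[simplified])
    then show ?thesis by (rule embedsI_indexed[OF v g loop_free])
  next
    assume no: "{v 0, v 2} \<notin> E \<and> {v 2, v 4} \<notin> E \<and> {v 0, v 4} \<notin> E"
    let ?g = "(!) [1, 2, 3, 4, 5, 6 :: nat]"
    have g: "bij_betw ?g {..<6} (verts three_sun)"
      by (auto simp: bij_betw_def inj_on_def six three_sun_def)
    have "{?g i, ?g j} \<in> edges three_sun" if "i < j" "j < 6" "{v i, v j} \<in> E" for i j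
      using cases[OF that(1,2)] that(3) no long
      by (elim disjE conjE) (simp_all add: sun[simplified])
    then show ?thesis by (rule embedsI_indexed[OF v g loop_free])
  qed
qed

lemma cycle_graph_or_three_sun:
  assumes n: "6 \<le> card V" and not_col: "\<not> colorable V E (card V - 3)"
  shows "graph_iso (V, E) (cycle_graph (card V)) \<or> embeds V E three_sun"
proof -
  have "v ` {..<k} \<subseteq> V" using cycle_vertex by auto
  then have V: "V = v ` {..<k}" using colorable_if_not_Hamiltonian[OF _ n] not_col by blast
  have v: "bij_betw v {..<k} V" using V cycle_inj by (auto simp: bij_betw_def inj_on_def)
  then have k: "card V = k" using bij_betw_same_card by fastforce
  have cyc: "{v i, v (Suc i mod k)} \<in> E" if "i < k" for i
    using branch_cycleD(3)[OF cycle that] by (simp add: touch_def)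
  show ?thesis
  proof (cases "\<exists>i<k. \<exists>j<k. {v i, v j} \<in> E \<and> j \<noteq> Suc i mod k \<and> i \<noteq> Suc j mod k")
    case True
    then obtain i j where ij: "i < k" "j < k" "{v i, v j} \<in> E" "j \<noteq> Suc i mod k" "i \<noteq> Suc j mod k"
      by blast
    obtain r l where rl: "2 \<le> l" "2 * l \<le> k" "{v (r mod k), v ((l + r) mod k)} \<in> E"
      using chord_arc[OF ij(3,1,2,4,5)] by blast
    have "\<not> 7 \<le> k" using colorable_rotated_chord[OF rl(3,1,2)] not_col by blast
    then have "k = 6" using n k by simp
    then show ?thesis using six_cycle_embeds_three_sun[OF _ V not_col] by simp
  next
    case False
    let ?f = "inv_into {..<k} v"
    have f: "?f (v i) = i" if "i < k" for i
      using v that by (simp add: bij_betw_def inv_into_f_f)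
    have "adj (V, E) x y \<longleftrightarrow> adj (cycle_graph k) (?f x) (?f y)" if xy: "x \<in> V" "y \<in> V" for x y
    proof -
      obtain i j where ij: "x = v i" "y = v j" "i < k" "j < k" using xy V by auto
      have "{v i, v j} \<in> E \<longleftrightarrow> j = Suc i mod k \<or> i = Suc j mod k"
        using cyc[OF ij(3)] cyc[OF ij(4)] False ij(3,4) by (auto simp: insert_commute)
      also have "\<dots> \<longleftrightarrow> {i, j} \<in> edges (cycle_graph k)"
        using ij(3,4) by (auto simp: cycle_graph_def doubleton_eq_iff)
      finally show ?thesis using f ij by (simp add: adj_def)
    qed
    then have "graph_iso (V, E) (cycle_graph k)"
      unfolding graph_iso_def using bij_betw_inv_into[OF v]
      by (intro exI[of _ ?f]) (simp add: cycle_graph_def)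
    then show ?thesis by (simp add: k)
  qed
qed

end

lemma two_connected_if_k_connected:
  assumes "simple_graph G" "k_connected 2 G"
  shows "two_connected (verts G) (edges G)"
proof -
  have conn: "conn (edges G) (verts G - X)" if "X \<subseteq> verts G" "card X < 2" for X
  proof -
    have "{e \<in> edges G. e \<inter> X = {}} = {e \<in> edges G. e \<subseteq> verts G - X}"
      using assms(1) by (auto simp: simple_graph_def)
    moreover have "connected_graph (delete_verts G X)"
      using assms(2) that by (simp add: k_connected_def)
    ultimately show ?thesis
      by (simp add: connected_graph_def adj_rtranclp delete_verts_def conn_def)
  qed
  show ?thesis
  proof
    show "finite (verts G)" using assms(1) by (simp add: simple_graph_def)
    show "3 \<le> card (verts G)" using assms(2) by (simp add: k_connected_def)
    show "conn (edges G) (verts G)" using conn[of "{}"] by simp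
    show "conn (edges G) (verts G - {x})" if "x \<in> verts G" for x using conn[of "{x}"] that by simp
    show "\<exists>x y. e = {x, y} \<and> x \<noteq> y \<and> x \<in> verts G \<and> y \<in> verts G" if "e \<in> edges G" for e
      using simple_graph_edgeE[OF assms(1) that] by metis
  qed
qed

theorem theorem8:
  fixes G :: "'a ugraph" and n :: nat
  assumes "simple_graph G"
    and "k_connected 2 G"
    and "card (verts G) = n"
    and "n \<ge> 4"
  shows "rx3 G \<le> n - 2 \<and>
    (rx3 G = n - 2 \<longleftrightarrow>
       graph_iso G (cycle_graph n) \<or>
       (\<exists>H. spanning_subgraph H three_sun \<and> graph_iso G H) \<or>
       (\<exists>H. spanning_subgraph H K5_minus_edge \<and> graph_iso G H) \<or>
       (\<exists>H. spanning_subgraph H (complete_graph 4) \<and> graph_iso G H))"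
proof -
  let ?V = "verts G" and ?E = "edges G"
  interpret two_connected ?V ?E by (rule two_connected_if_k_connected[OF assms(1,2)])
  obtain k v where "branch_cycle ?V ?E k (\<lambda>i. {v i})" "\<nexists>B. branch_cycle ?V ?E (Suc k) B"
    using longest_cycle_exists by auto
  then interpret longest_cycle ?V ?E k v by unfold_locales
  note embeds_iff = embeds_iff_spanning_subgraph[OF assms(1), symmetric]
  have upper: "colorable ?V ?E (n - 2)" using colorable_minus_2 assms(3,4) by simp
  have le: "rx3 G \<le> n - 2" by (rule rx3_le[OF assms(1) upper])
  have "rx3 G = n - 2 \<longleftrightarrow> \<not> colorable ?V ?E (n - 3)"
  proof
    assume "rx3 G = n - 2"
    then have "\<not> rx3 G \<le> n - 3" using assms(4) by simp
    then show "\<not> colorable ?V ?E (n - 3)" using rx3_le[OF assms(1)] by blast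
  next
    assume not_col: "\<not> colorable ?V ?E (n - 3)"
    have "\<not> rx3 G \<le> n - 3" using colorable_mono[OF colorable_rx3[OF assms(1) upper]] not_col by blast
    then show "rx3 G = n - 2" using le by simp
  qed
  also have "\<dots> \<longleftrightarrow> graph_iso G (cycle_graph n) \<or> embeds ?V ?E three_sun \<or>
      embeds ?V ?E K5_minus_edge \<or> embeds ?V ?E (complete_graph 4)"
  proof
    assume not_col: "\<not> colorable ?V ?E (n - 3)"
    consider "n = 4" | "n = 5" | "6 \<le> n" using assms(4) by linarith
    then show "graph_iso G (cycle_graph n) \<or> embeds ?V ?E three_sun \<or>
      embeds ?V ?E K5_minus_edge \<or> embeds ?V ?E (complete_graph 4)"
    proof cases
      case 1
      then show ?thesis using embeds_complete_graph assms(3) by simp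
    next
      case 2
      then show ?thesis using five_vertices assms(3) not_col by simp
    next
      case 3
      then show ?thesis
        using cycle_graph_or_three_sun[unfolded assms(3) prod.collapse, OF 3 not_col] by blast
    qed
  next
    have order_eq: "card (verts K) = n" if "embeds ?V ?E K" for K :: "nat ugraph"
      using that assms(3) bij_betw_same_card unfolding embeds_def by fastforce
    assume "graph_iso G (cycle_graph n) \<or> embeds ?V ?E three_sun \<or>
      embeds ?V ?E K5_minus_edge \<or> embeds ?V ?E (complete_graph 4)"
    then consider "graph_iso G (cycle_graph n)" | "embeds ?V ?E three_sun"
      | "embeds ?V ?E K5_minus_edge" | "embeds ?V ?E (complete_graph 4)" by blast
    then show "\<not> colorable ?V ?E (n - 3)"
    proof cases
      case 1
      then have "embeds ?V ?E (cycle_graph n)" by (auto simp: graph_iso_def embeds_def adj_def)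
      moreover have "simple_graph (cycle_graph n)" using simple_cycle_graph assms(4) by simp
      ultimately show ?thesis
        using not_colorable_if_embeds not_colorable_cycle_graph[OF assms(4)] by blast
    next
      case 2
      then have "n = 6" using order_eq[OF 2] by (simp add: three_sun_def)
      then show ?thesis
        using not_colorable_if_embeds[OF 2 simple_three_sun not_colorable_three_sun] by simp
    next
      case 3
      then have "n = 5" using order_eq[OF 3] by (simp add: K5_minus_edge_def complete_graph_def)
      then show ?thesis
        using not_colorable_if_embeds[OF 3 simple_K5_minus_edge not_colorable_K5_minus_edge] by simp
    next
      case 4
      then have "n = 4" using order_eq[OF 4] by (simp add: complete_graph_def)
      moreover have "finite e" if "e \<in> ?E" for e using edge[OF that] by auto
      ultimately show ?thesis using not_colorable_1[OF order finite_E] by simp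
    qed
  qed
  finally show ?thesis
    using le unfolding embeds_iff[OF simple_three_sun] embeds_iff[OF simple_K5_minus_edge]
      embeds_iff[OF simple_complete_graph] by blast
qed


end
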